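(* Let $n=2m$ with $m\ge2$ an integer. Then the ratio of the number of irreducible representations of $J_n=\mathbb{C}^{S_{n-1}}\#\mathbb{C}C_n$ of dimension $2$ with Frobenius-Schur indicator $+1$ or $-1$ (i.e. nonzero indicator) to the total number of irreducible representations of $J_n$ of dimension $2$ converges to $0$ as $m\to\infty$.
   Context: Identify $\{1,\dots,n\}$ with $\mathbb{Z}/n\mathbb{Z}$ and $S_n$ with the bijections of $\mathbb{Z}/n\mathbb{Z}$ under composition (right-to-left). $S_{n-1}$ is the subgroup of those $x$ with $x(n)=n$; $a=(1\,2\,\cdots\,n)$; $C_n=\langle a\rangle$. Each product $xa^r$ ($x\in S_{n-1}$) factors uniquely as $xa^r=(x\rhd a^r)(x\lhd a^r)$ with $x\rhd a^r\in C_n$, $x\lhd a^r\in S_{n-1}$; explicitly $x\rhd a^r=a^{x(r)}$ and $x\lhd a^r=a^{-x(r)}xa^r$. $\lhd$ is a right action of $C_n$ on the set $S_{n-1}$; $F_x$ is the stabilizer of $x$. $J_n$ is the semisimple Hopf algebra over $\mathbb{C}$ with basis $p_y\#b$ ($y\in S_{n-1}$, $b\in C_n$), product $(p_y\#b)(p_z\#c)=\delta_{z,\,y\lhd b}\,p_y\#bc$, unit $\sum_y p_y\#1$, counit $\varepsilon(p_y\#b)=\delta_{y,1}$, coproduct $\Delta(p_y\#b)=\sum_{z}(p_{yz^{-1}}\#(z\rhd b))\otimes(p_z\#b)$, antipode $S(p_y\#b)=p_{(y\lhd b)^{-1}}\#(y\rhd b)^{-1}$. For an irreducible representation $V$ of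 $F_x$, the induced irreducible $J_n$-module is $\hat V=\mathbb{C}C_n\otimes_{\mathbb{C}F_x}V$ with $(p_y\#b)\cdot(c\otimes v)=\delta_{y\lhd(bc),x}\,(bc\otimes v)$; its dimension is $[C_n:F_x]$. The Frobenius-Schur indicator of a $J_n$-module with character $\chi$ is $\nu(\chi)=\chi(\sum\Lambda_1\Lambda_2)$, where $\Lambda$ is the two-sided integral of $J_n$ with $\varepsilon(\Lambda)=1$ and $\Delta(\Lambda)=\sum\Lambda_1\otimes\Lambda_2$. Counting convention: the irreducible representations of dimension $2$ are counted as pairs $(x,\rho)$ with $x\in S_{n-1}$, $F_x=\langle a^2\rangle$ (of index $2$), and $\rho$ one of the $n/2$ irreducible representations of $F_x$; the indicator attached to $(x,\rho)$ is that of the $J_n$-module induced from $\rho$ via $x$. The ratio is considered for $m$ large enough that the total number is nonzero. *)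

theory Defs
  imports
    Complex_Main
    "HOL-Combinatorics.Cycles"
    "Jordan_Normal_Form.Matrix"
    "Jordan_Normal_Form.Determinant"
begin

section \<open>The matched pair\<close>

text \<open>
  Permutations of \<open>{1..n}\<close> are functions on \<^typ>\<open>nat\<close> that are the identity outside \<open>{1..n}\<close>.
  The points \<open>1, ..., n\<close> are the residues modulo \<open>n\<close>, so \<open>n\<close> plays the role of \<open>0\<close>.
\<close>

type_synonym prm = "nat \<Rightarrow> nat"

definition Sn1 :: "nat \<Rightarrow> prm set" where
  "Sn1 n = {x. x permutes {1..n} \<and> x n = n}"

definition cyc :: "nat \<Rightarrow> prm" where
  "cyc n = cycle_of_list [1..<Suc n]"

definition Cn :: "nat \<Rightarrow> prm set" where
  "Cn n = {cyc n ^^ r | r. True}"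

text \<open>
  An element \<open>c = a^r\<close> of \<open>C_n\<close> with \<open>1 \<le> r \<le> n\<close> satisfies \<open>c n = r\<close>, so the exponent
  \<open>x(r)\<close> in \<open>x \<rhd> a^r = a^(x(r))\<close> is \<open>x (c n)\<close>.
\<close>

definition lact :: "nat \<Rightarrow> prm \<Rightarrow> prm \<Rightarrow> prm" where
  "lact n x c = cyc n ^^ (x (c n))"

definition ract :: "nat \<Rightarrow> prm \<Rightarrow> prm \<Rightarrow> prm" where
  "ract n x c = inv_into UNIV (lact n x c) \<circ> x \<circ> c"

definition Fstab :: "nat \<Rightarrow> prm \<Rightarrow> prm set" where
  "Fstab n x = {c \<in> Cn n. ract n x c = x}"

lemma cyc_permutes: "cyc n permutes {1..n}"
proof -
  have "set [1..<Suc n] = {1..n}" by auto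
  then show ?thesis unfolding cyc_def using cycle_permutes[of "[1..<Suc n]"] by simp
qed

lemma cyc_pow_permutes: "(cyc n ^^ r) permutes {1..n}"
  by (rule permutes_funpow[OF cyc_permutes])

lemma cyc_pow_n:
  assumes "1 \<le> r" "r \<le> n"
  shows "(cyc n ^^ r) n = r"
proof -
  let ?cs = "[1..<Suc n]"
  have "map (cyc n ^^ r) ?cs = rotate r ?cs"
    unfolding cyc_def by (rule cyclic_rotation) simp
  then have "map (cyc n ^^ r) ?cs ! (n - 1) = rotate r ?cs ! (n - 1)" by simp
  moreover have "map (cyc n ^^ r) ?cs ! (n - 1) = (cyc n ^^ r) n"
    using assms by (simp del: upt_Suc)
  moreover have "rotate r ?cs ! (n - 1) = ?cs ! ((r + (n - 1)) mod n)"
    using assms by (subst nth_rotate) (simp_all del: upt_Suc add: add.commute)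
  moreover have "(r + (n - 1)) mod n = r - 1"
  proof -
    have "r + (n - 1) = (r - 1) + n" using assms by simp
    moreover have "((r - 1) + n) mod n = (r - 1) mod n" by (rule mod_add_self2)
    moreover have "(r - 1) mod n = r - 1" using assms by simp
    ultimately show ?thesis by metis
  qed
  ultimately show ?thesis using assms by (simp del: upt_Suc)
qed

lemma cyc_pow_self: "cyc n ^^ n = id"
proof -
  have "cycle_of_list [1..<Suc n] ^^ length [1..<Suc n] = id"
    by (rule cycle_is_id_root) simp
  then show ?thesis unfolding cyc_def by (simp del: upt_Suc)
qed

lemma Cn_eq_pow_at_n:
  assumes "1 \<le> n" "c \<in> Cn n"
  shows "c n \<in> {1..n}" "c = cyc n ^^ (c n)"
proof -
  from assms obtain k where k: "c = cyc n ^^ k" by (auto simp: Cn_def)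
  show "c n \<in> {1..n}"
    unfolding k using assms(1) by (subst permutes_in_image[OF cyc_pow_permutes]) simp
  define s where "s = (if k mod n = 0 then n else k mod n)"
  have mod: "cyc n ^^ k = cyc n ^^ (k mod n)"
    by (rule ext, rule funpow_mod_eq[symmetric]) (simp add: cyc_pow_self)
  have "c = cyc n ^^ s" using mod k cyc_pow_self[of n] by (auto simp: s_def)
  moreover have "1 \<le> s" "s \<le> n" using assms(1) by (auto simp: s_def less_imp_le)
  ultimately show "c = cyc n ^^ (c n)" using cyc_pow_n by metis
qed

text \<open>\<^const>\<open>lact\<close> and \<^const>\<open>ract\<close> are the two factors of the unique factorization of \<open>x c\<close>.\<close>

lemma unique_factorization:
  assumes "1 \<le> n" "x \<in> Sn1 n" "c \<in> Cn n"
  shows "lact n x c \<in> Cn n" "ract n x c \<in> Sn1 n" "x \<circ> c = lact n x c \<circ> ract n x c"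
    "\<And>c' x'. c' \<in> Cn n \<Longrightarrow> x' \<in> Sn1 n \<Longrightarrow> x \<circ> c = c' \<circ> x' \<Longrightarrow> c' = lact n x c \<and> x' = ract n x c"
proof -
  have x: "x permutes {1..n}" "x n = n" using assms by (auto simp: Sn1_def)
  have c: "c permutes {1..n}" using assms cyc_pow_permutes by (auto simp: Cn_def)
  have r: "x (c n) \<in> {1..n}"
    using permutes_in_image[OF x(1)] Cn_eq_pow_at_n(1)[OF assms(1,3)] by blast
  have l: "lact n x c permutes {1..n}" unfolding lact_def by (rule cyc_pow_permutes)
  have l_n: "lact n x c n = x (c n)" using r cyc_pow_n by (auto simp: lact_def)
  show "lact n x c \<in> Cn n" by (auto simp: lact_def Cn_def)
  have "ract n x c permutes {1..n}"
    unfolding ract_def using c x l by (intro permutes_compose permutes_inv)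
  moreover have "ract n x c n = n"
    using l_n permutes_inverses(2)[OF l, of n] by (simp add: ract_def)
  ultimately show "ract n x c \<in> Sn1 n" by (simp add: Sn1_def)
  show "x \<circ> c = lact n x c \<circ> ract n x c"
    using permutes_inverses(1)[OF l] by (auto simp: ract_def fun_eq_iff)
  fix c' x' assume A: "c' \<in> Cn n" "x' \<in> Sn1 n" "x \<circ> c = c' \<circ> x'"
  have "x' n = n" using A(2) by (simp add: Sn1_def)
  then have "c' n = x (c n)" using fun_cong[OF A(3), of n] by simp
  then have c': "c' = lact n x c" 
    unfolding lact_def using Cn_eq_pow_at_n(2)[OF assms(1) A(1)] by metis
  have "x' = ract n x c"
  proof
    fix t
    have "x (c t) = lact n x c (x' t)" using fun_cong[OF A(3), of t] c' by simp
    then show "x' t = ract n x c t"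
      unfolding ract_def using permutes_inverses(2)[OF l, of "x' t"] by simp
  qed
  with c' show "c' = lact n x c \<and> x' = ract n x c" by simp
qed


section \<open>The Hopf algebra \<open>J_n\<close>\<close>

text \<open>
  An element of \<open>J_n\<close> is its coefficient function on the basis \<open>S_{n-1} \<times> C_n\<close>, extended by \<open>0\<close>;
  the pair \<open>(y, b)\<close> stands for \<open>p_y # b\<close>. An element of \<open>J_n \<otimes> J_n\<close> is likewise a function on
  pairs of basis indices. All structure maps are the linear extensions of their values on the basis.
\<close>

type_synonym jelt = "prm \<times> prm \<Rightarrow> complex"
type_synonym jtens = "(prm \<times> prm) \<times> (prm \<times> prm) \<Rightarrow> complex"

definition Jidx :: "nat \<Rightarrow> (prm \<times> prm) set" where
  "Jidx n = Sn1 n \<times> Cn n"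

definition Jcar :: "nat \<Rightarrow> jelt set" where
  "Jcar n = {f. \<forall>u. u \<notin> Jidx n \<longrightarrow> f u = 0}"

definition Jbas :: "prm \<Rightarrow> prm \<Rightarrow> jelt" where
  "Jbas y b = (\<lambda>u. if u = (y, b) then 1 else 0)"

definition tens :: "jelt \<Rightarrow> jelt \<Rightarrow> jtens" where
  "tens f g = (\<lambda>(u, v). f u * g v)"

definition Jmult_bas :: "nat \<Rightarrow> prm \<times> prm \<Rightarrow> prm \<times> prm \<Rightarrow> jelt" where
  "Jmult_bas n = (\<lambda>(y, b) (z, c). if z = ract n y b then Jbas y (b \<circ> c) else (\<lambda>_. 0))"

definition Jmu :: "nat \<Rightarrow> jtens \<Rightarrow> jelt" where
  "Jmu n T = (\<lambda>w. \<Sum>u\<in>Jidx n. \<Sum>v\<in>Jidx n. T (u, v) * Jmult_bas n u v w)"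

definition Jmult :: "nat \<Rightarrow> jelt \<Rightarrow> jelt \<Rightarrow> jelt" where
  "Jmult n f g = Jmu n (tens f g)"

definition Jone :: "nat \<Rightarrow> jelt" where
  "Jone n = (\<lambda>w. \<Sum>y\<in>Sn1 n. Jbas y id w)"

definition Jcounit :: "nat \<Rightarrow> jelt \<Rightarrow> complex" where
  "Jcounit n f = (\<Sum>(y, b)\<in>Jidx n. f (y, b) * (if y = id then 1 else 0))"

definition Jcomult :: "nat \<Rightarrow> jelt \<Rightarrow> jtens" where
  "Jcomult n f = (\<lambda>t. \<Sum>(y, b)\<in>Jidx n. f (y, b) *
     (\<Sum>z\<in>Sn1 n. tens (Jbas (y \<circ> inv_into UNIV z) (lact n z b)) (Jbas z b) t))"

definition Jantipode :: "nat \<Rightarrow> jelt \<Rightarrow> jelt" where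
  "Jantipode n f = (\<lambda>w. \<Sum>(y, b)\<in>Jidx n. f (y, b) * Jbas (inv_into UNIV (ract n y b)) (inv_into UNIV (lact n y b)) w)"

definition Jintegral :: "nat \<Rightarrow> jelt" where
  "Jintegral n = (THE L. L \<in> Jcar n \<and> Jcounit n L = 1 \<and>
     (\<forall>h\<in>Jcar n. Jmult n h L = (\<lambda>w. Jcounit n h * L w) \<and>
                 Jmult n L h = (\<lambda>w. Jcounit n h * L w)))"


section \<open>Modules and Frobenius-Schur indicators\<close>

text \<open>
  Finite-dimensional modules are given in matrix form: a \<open>d\<close>-dimensional \<open>J_n\<close>-module is a unital
  algebra homomorphism \<open>R\<close> from \<open>J_n\<close> to the \<open>d \<times> d\<close> matrices.
\<close>

definition is_Jmodule :: "nat \<Rightarrow> nat \<Rightarrow> (jelt \<Rightarrow> complex mat) \<Rightarrow> bool" where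
  "is_Jmodule n d R \<longleftrightarrow>
     (\<forall>f\<in>Jcar n. R f \<in> carrier_mat d d) \<and>
     (\<forall>f\<in>Jcar n. \<forall>g\<in>Jcar n. R (\<lambda>w. f w + g w) = R f + R g) \<and>
     (\<forall>f\<in>Jcar n. \<forall>s. R (\<lambda>w. s * f w) = s \<cdot>\<^sub>m R f) \<and>
     (\<forall>f\<in>Jcar n. \<forall>g\<in>Jcar n. R (Jmult n f g) = R f * R g) \<and>
     R (Jone n) = 1\<^sub>m d"

definition mtrace :: "complex mat \<Rightarrow> complex" where
  "mtrace A = (\<Sum>i<dim_row A. A $$ (i, i))"

definition FS_indicator :: "nat \<Rightarrow> (jelt \<Rightarrow> complex mat) \<Rightarrow> complex" where
  "FS_indicator n R = mtrace (R (Jmu n (Jcomult n (Jintegral n))))"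

definition is_rep :: "prm set \<Rightarrow> nat \<Rightarrow> (prm \<Rightarrow> complex mat) \<Rightarrow> bool" where
  "is_rep H k \<rho> \<longleftrightarrow> (\<forall>h\<in>H. \<rho> h \<in> carrier_mat k k) \<and> \<rho> id = 1\<^sub>m k \<and>
     (\<forall>g\<in>H. \<forall>h\<in>H. \<rho> (g \<circ> h) = \<rho> g * \<rho> h)"

definition is_linear_subspace :: "nat \<Rightarrow> complex vec set \<Rightarrow> bool" where
  "is_linear_subspace k U \<longleftrightarrow> U \<subseteq> carrier_vec k \<and> 0\<^sub>v k \<in> U \<and>
     (\<forall>v\<in>U. \<forall>w\<in>U. v + w \<in> U) \<and> (\<forall>s. \<forall>v\<in>U. s \<cdot>\<^sub>v v \<in> U)"

definition is_irrep :: "prm set \<Rightarrow> nat \<Rightarrow> (prm \<Rightarrow> complex mat) \<Rightarrow> bool" where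
  "is_irrep H k \<rho> \<longleftrightarrow> is_rep H k \<rho> \<and> k > 0 \<and>
     (\<forall>U. is_linear_subspace k U \<and> (\<forall>h\<in>H. \<forall>v\<in>U. \<rho> h *\<^sub>v v \<in> U) \<longrightarrow>
          U = {0\<^sub>v k} \<or> U = carrier_vec k)"

definition irreps :: "prm set \<Rightarrow> (nat \<times> (prm \<Rightarrow> complex mat)) set" where
  "irreps H = {(k, \<rho>). is_irrep H k \<rho>}"

definition rep_iso :: "prm set \<Rightarrow>
    ((nat \<times> (prm \<Rightarrow> complex mat)) \<times> (nat \<times> (prm \<Rightarrow> complex mat))) set" where
  "rep_iso H = {((k, \<rho>), (k', \<rho>')). (k, \<rho>) \<in> irreps H \<and> (k', \<rho>') \<in> irreps H \<and> k' = k \<and>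
     (\<exists>A\<in>carrier_mat k k. invertible_mat A \<and> (\<forall>h\<in>H. A * \<rho> h = \<rho>' h * A))}"

text \<open>The set of isomorphism classes of irreducible complex representations of the group \<open>H\<close>.\<close>

definition Irr :: "prm set \<Rightarrow> (nat \<times> (prm \<Rightarrow> complex mat)) set set" where
  "Irr H = irreps H // rep_iso H"

text \<open>
  \<open>\<complex>C_n \<otimes> V\<close>, balanced over \<open>\<complex>F\<close>, by its universal property. Here \<open>V = \<complex>^k\<close> with \<open>F\<close> acting by
  \<open>\<rho>\<close>, the tensor product is \<open>\<complex>^d\<close>, and the matrix \<open>P c\<close> is the linear map \<open>v \<mapsto> c \<otimes> v\<close>. A bilinear map
  \<open>\<complex>C_n \<times> V \<rightarrow> \<complex>^e\<close> amounts to a family of \<open>e \<times> k\<close> matrices indexed by \<open>C_n\<close>.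
\<close>

definition balanced :: "nat \<Rightarrow> prm set \<Rightarrow> nat \<Rightarrow> (prm \<Rightarrow> complex mat) \<Rightarrow>
    nat \<Rightarrow> (prm \<Rightarrow> complex mat) \<Rightarrow> bool" where
  "balanced n F k \<rho> e Q \<longleftrightarrow> (\<forall>c\<in>Cn n. Q c \<in> carrier_mat e k) \<and>
     (\<forall>c\<in>Cn n. \<forall>f\<in>F. Q (c \<circ> f) = Q c * \<rho> f)"

definition is_tensor :: "nat \<Rightarrow> prm set \<Rightarrow> nat \<Rightarrow> (prm \<Rightarrow> complex mat) \<Rightarrow>
    nat \<Rightarrow> (prm \<Rightarrow> complex mat) \<Rightarrow> bool" where
  "is_tensor n F k \<rho> d P \<longleftrightarrow> balanced n F k \<rho> d P \<and>
     (\<forall>e Q. balanced n F k \<rho> e Q \<longrightarrow>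
        (\<exists>!T. T \<in> carrier_mat e d \<and> (\<forall>c\<in>Cn n. Q c = T * P c)))"

definition is_induced :: "nat \<Rightarrow> prm \<Rightarrow> nat \<Rightarrow> (prm \<Rightarrow> complex mat) \<Rightarrow>
    nat \<Rightarrow> (jelt \<Rightarrow> complex mat) \<Rightarrow> bool" where
  "is_induced n x k \<rho> d R \<longleftrightarrow> is_Jmodule n d R \<and>
     (\<exists>P. is_tensor n (Fstab n x) k \<rho> d P \<and>
        (\<forall>y\<in>Sn1 n. \<forall>b\<in>Cn n. \<forall>c\<in>Cn n. \<forall>v\<in>carrier_vec k.
           R (Jbas y b) *\<^sub>v (P c *\<^sub>v v) =
             (if ract n y (b \<circ> c) = x then P (b \<circ> c) *\<^sub>v v else 0\<^sub>v d)))"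

text \<open>
  The indicator depends only on \<open>x\<close> and the isomorphism class \<open>C\<close> of the representation of \<open>F_x\<close>,
  since the induced module is determined up to isomorphism.
\<close>

definition induced_indicator :: "nat \<Rightarrow> prm \<Rightarrow> (nat \<times> (prm \<Rightarrow> complex mat)) set \<Rightarrow> complex" where
  "induced_indicator n x C =
     (THE \<nu>. \<exists>k \<rho> d R. (k, \<rho>) \<in> C \<and> is_induced n x k \<rho> d R \<and> \<nu> = FS_indicator n R)"


section \<open>Counting\<close>

text \<open>Irreducible representations of dimension 2, counted as pairs of \<open>x\<close> with \<open>F_x = \<langle>a^2\<rangle>\<close> and an
  irreducible representation of \<open>F_x\<close>.\<close>

definition dim2_irreps :: "nat \<Rightarrow> (prm \<times> (nat \<times> (prm \<Rightarrow> complex mat)) set) set" where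
  "dim2_irreps n = {(x, C). x \<in> Sn1 n \<and> Fstab n x = {(cyc n ^^ 2) ^^ k | k. True} \<and>
     C \<in> Irr (Fstab n x)}"

definition dim2_irreps_pm1 :: "nat \<Rightarrow> (prm \<times> (nat \<times> (prm \<Rightarrow> complex mat)) set) set" where
  "dim2_irreps_pm1 n = {(x, C) \<in> dim2_irreps n. induced_indicator n x C \<in> {1, -1}}"

end

theory Submission
  imports Defs "HOL-Number_Theory.Cong" "Jordan_Normal_Form.Spectral_Radius"
begin

text \<open>
  If \<open>F\<^sub>x = \<langle>a\<^sup>2\<rangle>\<close> then \<open>x (t + 2) = x t + s\<close> modulo \<open>n = 2m\<close> with an even \<open>s = 2u\<close>, and the slope \<open>s\<close> is
  shared by the whole orbit of \<open>x\<close>. The element \<open>\<Sum>\<Lambda>\<^sub>1\<Lambda>\<^sub>2\<close> is supported on those \<open>p\<^sub>y # b\<close> for which \<open>y\<close>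
  and its inverse lie in one orbit, and a module induced via \<open>x\<close> is killed by \<open>p\<^sub>y # b\<close> unless \<open>y\<close> lies
  in the orbit of \<open>x\<close>. So a nonzero indicator forces the slopes of a permutation and its inverse to
  agree, that is \<open>u\<^sup>2 = 1\<close> modulo \<open>m\<close>.

  Multiplication by a unit \<open>w\<close> of \<open>\<int>/n\<int>\<close> preserves \<open>F\<^sub>x\<close> and turns \<open>u\<close> into \<open>wu\<close>; hence \<open>K\<close> units with
  distinct squares modulo \<open>m\<close> give \<open>K\<close> disjoint translates of the set of such \<open>x\<close>, whose proportion is
  therefore at most \<open>1/K\<close>. The powers \<open>w\<^sup>i\<close>, \<open>i < K\<close>, of one suitable unit \<open>w\<close> have this property once
  \<open>81\<^sup>K \<le> m\<close>.
\<close>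

section \<open>The matched pair on residues\<close>

text \<open>Subtracting one moves the representatives \<open>1..n\<close> to the standard residues
  below \<open>n\<close>, where congruence is equality.\<close>

lemma cong_imp_eq_atLeastAtMost:
  fixes p q n :: nat
  assumes "[p = q] (mod n)" "p \<in> {1..n}" "q \<in> {1..n}"
  shows "p = q"
proof -
  have "[p - 1 = q - 1] (mod n)"
    using assms cong_add_rcancel_nat[of "p - 1" 1 "q - 1" n] by simp
  moreover have "p - 1 < n" "q - 1 < n" using assms by auto
  ultimately have "p - 1 = q - 1" by (simp add: cong_def)
  then show ?thesis using assms by auto
qed

lemma cyc_pow_add: "(cyc n ^^ r) ((cyc n ^^ s) t) = (cyc n ^^ (r + s)) t"
  by (simp add: funpow_add)

lemma cyc_pow_in:
  assumes "t \<in> {1..n}"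
  shows "(cyc n ^^ r) t \<in> {1..n}"
  using assms permutes_in_image[OF cyc_pow_permutes[of r n], of t] by simp

lemma cyc_pow_mod: "cyc n ^^ (r mod n) = cyc n ^^ r"
  by (rule ext, rule funpow_mod_eq) (simp add: cyc_pow_self)

lemma cyc_pow_cong:
  assumes "[r = s] (mod n)"
  shows "cyc n ^^ r = cyc n ^^ s"
  using assms cyc_pow_mod[of r n] cyc_pow_mod[of s n] by (simp add: cong_def)

text \<open>The point \<open>n\<close> is the residue 0, so the value there recovers the exponent.
  Since \<open>cyc_pow_n\<close> covers exponents in \<open>1..n\<close>, multiples of
  \<open>n\<close> are treated apart.\<close>

lemma cyc_pow_at_n:
  assumes "1 \<le> n"
  shows "[(cyc n ^^ r) n = r] (mod n)"
proof (cases "r mod n = 0")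
  case True
  then have "cyc n ^^ r = id" using cyc_pow_mod[of r n] by simp
  with True show ?thesis by (simp add: cong_def)
next
  case False
  then have "(cyc n ^^ (r mod n)) n = r mod n"
    using assms by (intro cyc_pow_n) (auto simp: less_imp_le)
  then show ?thesis using cyc_pow_mod[of r n] by (simp add: cong_def)
qed

lemma cyc_pow_point:
  assumes "1 \<le> n" "t \<in> {1..n}"
  shows "[(cyc n ^^ r) t = r + t] (mod n)"
proof -
  have "(cyc n ^^ t) n = t" using assms by (intro cyc_pow_n) auto
  then have "(cyc n ^^ r) t = (cyc n ^^ (r + t)) n" by (metis cyc_pow_add)
  then show ?thesis using cyc_pow_at_n[OF assms(1), of "r + t"] by simp
qed

text \<open>The periodic extension to all naturals of a permutation of \<open>\<int>/n\<int>\<close>.\<close>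

definition pext :: "nat \<Rightarrow> prm \<Rightarrow> nat \<Rightarrow> nat" where
  "pext n x t = x ((cyc n ^^ t) n)"

lemma pext_cong:
  assumes "[s = t] (mod n)"
  shows "pext n x s = pext n x t"
  using cyc_pow_cong[OF assms] by (simp add: pext_def)

lemma pext_eq:
  assumes "t \<in> {1..n}"
  shows "pext n x t = x t"
  using assms cyc_pow_n[of t n] by (simp add: pext_def)

lemma Sn1_in:
  assumes "x \<in> Sn1 n" "t \<in> {1..n}"
  shows "x t \<in> {1..n}"
  using assms permutes_in_image[of x "{1..n}" t] by (simp add: Sn1_def)

lemma pext_in:
  assumes "1 \<le> n" "x \<in> Sn1 n"
  shows "pext n x t \<in> {1..n}"
  using assms Sn1_in[OF assms(2) cyc_pow_in[of n n t]] by (simp add: pext_def)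

lemma pext_0:
  assumes "x \<in> Sn1 n"
  shows "pext n x 0 = n"
  using assms by (simp add: pext_def Sn1_def)

lemma Sn1_eqI:
  assumes "x \<in> Sn1 n" "y \<in> Sn1 n" "\<And>t. t \<in> {1..n} \<Longrightarrow> [x t = y t] (mod n)"
  shows "x = y"
proof
  fix t
  show "x t = y t"
  proof (cases "t \<in> {1..n}")
    case True
    then show ?thesis using assms Sn1_in by (intro cong_imp_eq_atLeastAtMost) auto
  next
    case False
    then have "x t = t" "y t = t"
      using assms(1,2) permutes_not_in[of _ "{1..n}" t] by (auto simp: Sn1_def)
    then show ?thesis by simp
  qed
qed

section \<open>The group \<open>Cn\<close> and its right action on \<open>Sn1\<close>\<close>

lemma cyc_pow_Cn [simp]: "cyc n ^^ r \<in> Cn n"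
  by (auto simp: Cn_def)

lemma Cn_cases:
  assumes "c \<in> Cn n"
  obtains r where "c = cyc n ^^ r"
  using assms by (auto simp: Cn_def)

lemma id_Cn [simp]: "id \<in> Cn n"
  unfolding Cn_def using funpow_0 by (auto intro: exI[of _ 0])

lemma comp_Cn [simp]: "b \<in> Cn n \<Longrightarrow> c \<in> Cn n \<Longrightarrow> b \<circ> c \<in> Cn n"
  by (elim Cn_cases) (simp flip: funpow_add)

lemma Cn_commute: "b \<in> Cn n \<Longrightarrow> c \<in> Cn n \<Longrightarrow> b \<circ> c = c \<circ> b"
  by (elim Cn_cases) (simp add: add.commute flip: funpow_add)

text \<open>With natural exponents the inverse of \<open>a^r\<close> is \<open>a^(r(n-1))\<close>.
  For \<open>n = 0\<close> the cycle is that of the empty list, hence the identity.\<close>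

lemma Cn_inverse:
  assumes "c \<in> Cn n"
  obtains d where "d \<in> Cn n" "d \<circ> c = id" "c \<circ> d = id"
proof -
  obtain r where r: "c = cyc n ^^ r" using assms by (rule Cn_cases)
  show ?thesis
  proof (cases "n = 0")
    case True
    then have "c = id" using r by (simp add: cyc_def)
    then show ?thesis using that[of id] by simp
  next
    case False
    define d where "d = cyc n ^^ (r * (n - 1))"
    have "r * (n - 1) + r = r * n" using False by (cases n) auto
    then have "[r * (n - 1) + r = 0] (mod n)" by (simp add: cong_def)
    then have "cyc n ^^ (r * (n - 1) + r) = id"
      using cyc_pow_cong[of "r * (n - 1) + r" 0 n] by simp
    then have "d \<circ> c = id" by (simp add: d_def r funpow_add)
    moreover have "d \<in> Cn n" by (simp add: d_def)
    ultimately show ?thesis using that[of d] Cn_commute[OF assms, of d] by simp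
  qed
qed

lemma finite_Cn [simp]: "finite (Cn n)"
proof -
  have "Cn n \<subseteq> {p. p permutes {1..n}}" using cyc_pow_permutes by (auto simp: Cn_def)
  then show ?thesis by (rule finite_subset) (simp add: finite_permutations)
qed

lemma finite_Sn1 [simp]: "finite (Sn1 n)"
proof -
  have "Sn1 n \<subseteq> {p. p permutes {1..n}}" by (auto simp: Sn1_def)
  then show ?thesis by (rule finite_subset) (simp add: finite_permutations)
qed

lemma id_Sn1 [simp]: "id \<in> Sn1 n"
  by (simp add: Sn1_def permutes_id)

lemma inv_Sn1 [simp]: "x \<in> Sn1 n \<Longrightarrow> inv_into UNIV x \<in> Sn1 n"
  by (auto simp: Sn1_def permutes_inv permutes_inv_eq)

lemma lact_Cn [simp]: "lact n x c \<in> Cn n"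
  by (simp add: lact_def)

lemma ract_Sn1 [simp]:
  "1 \<le> n \<Longrightarrow> x \<in> Sn1 n \<Longrightarrow> c \<in> Cn n \<Longrightarrow> ract n x c \<in> Sn1 n"
  by (rule unique_factorization)

lemma ract_id [simp]:
  assumes "1 \<le> n" "x \<in> Sn1 n"
  shows "ract n x id = x"
  using unique_factorization(4)[OF assms id_Cn, of id x] assms by simp

lemma ract_id_left [simp]:
  assumes "1 \<le> n" "c \<in> Cn n"
  shows "ract n id c = id"
  using unique_factorization(4)[OF assms(1) id_Sn1 assms(2), of c id] assms by simp

text \<open>Factoring \<open>x b\<close> first, and then its \<open>Sn1\<close> part times
  \<open>c\<close>, yields a factorization of \<open>x (b c)\<close>; uniqueness identifies the
  second factor.\<close>

lemma ract_comp:
  assumes "1 \<le> n" "x \<in> Sn1 n" "b \<in> Cn n" "c \<in> Cn n"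
  shows "ract n (ract n x b) c = ract n x (b \<circ> c)"
proof -
  let ?y = "ract n x b"
  have y: "?y \<in> Sn1 n" using assms by simp
  have "x \<circ> (b \<circ> c) = (x \<circ> b) \<circ> c" by (simp add: comp_assoc)
  also have "\<dots> = lact n x b \<circ> (?y \<circ> c)"
    using unique_factorization(3)[OF assms(1,2,3)] by (simp add: comp_assoc)
  also have "\<dots> = (lact n x b \<circ> lact n ?y c) \<circ> ract n ?y c"
    using unique_factorization(3)[OF assms(1) y assms(4)] by (simp add: comp_assoc)
  finally show ?thesis
    using unique_factorization(4)[OF assms(1,2), of "b \<circ> c" "lact n x b \<circ> lact n ?y c" "ract n ?y c"]
      assms y by simp
qed

lemma ract_cancel:
  assumes "1 \<le> n" "x \<in> Sn1 n" "y \<in> Sn1 n" "c \<in> Cn n" "d \<in> Cn n" "c \<circ> d = id" "ract n x c = y"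
  shows "ract n y d = x"
  using assms ract_comp[OF assms(1,2,4,5)] by simp

text \<open>The factorization of \<open>x a^r\<close>, evaluated at the point \<open>t\<close>: the
  left factor is translation by \<open>x(r)\<close>. The formula \<open>x(r+t) - x(r)\<close> is
  written additively because the naturals lack negatives.\<close>

lemma pext_ract:
  assumes "1 \<le> n" "x \<in> Sn1 n"
  shows "[pext n (ract n x (cyc n ^^ r)) t + pext n x r = pext n x (r + t)] (mod n)"
proof -
  define c where "c = cyc n ^^ r"
  have c: "c \<in> Cn n" by (simp add: c_def)
  let ?w = "(cyc n ^^ t) n"
  have "(x \<circ> c) ?w = (lact n x c \<circ> ract n x c) ?w"
    using unique_factorization(3)[OF assms c] by simp
  then have "pext n x (r + t) = (cyc n ^^ pext n x r) (pext n (ract n x c) t)"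
    by (simp add: pext_def lact_def c_def funpow_add)
  moreover have "pext n (ract n x c) t \<in> {1..n}"
    using assms c by (intro pext_in) auto
  ultimately have "[pext n x (r + t) = pext n x r + pext n (ract n x c) t] (mod n)"
    using cyc_pow_point[OF assms(1)] by simp
  then have "[pext n (ract n x c) t + pext n x r = pext n x (r + t)] (mod n)"
    by (subst add.commute) (rule cong_sym)
  then show ?thesis by (simp only: c_def)
qed

text \<open>By \<open>pext_ract\<close> the action shifts the argument and subtracts the constant
  \<open>x(r)\<close>; cancelling this constant turns being fixed into additivity.\<close>

lemma Fstab_iff:
  assumes "1 \<le> n" "x \<in> Sn1 n"
  shows "cyc n ^^ r \<in> Fstab n x \<longleftrightarrow> (\<forall>t. [pext n x t + pext n x r = pext n x (r + t)] (mod n))"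
    (is "?L \<longleftrightarrow> ?R")
proof
  assume ?L
  then have "ract n x (cyc n ^^ r) = x" by (simp add: Fstab_def)
  then show ?R using pext_ract[OF assms, of r] by simp
next
  assume ?R
  have "ract n x (cyc n ^^ r) = x"
  proof (rule Sn1_eqI)
    show "ract n x (cyc n ^^ r) \<in> Sn1 n" "x \<in> Sn1 n" using assms by auto
    fix t assume t: "t \<in> {1..n}"
    have "[pext n (ract n x (cyc n ^^ r)) t + pext n x r = pext n x t + pext n x r] (mod n)"
      using pext_ract[OF assms, of r t] \<open>?R\<close> cong_sym cong_trans by blast
    then have "[pext n (ract n x (cyc n ^^ r)) t = pext n x t] (mod n)"
      by (simp add: cong_add_rcancel_nat)
    then show "[ract n x (cyc n ^^ r) t = x t] (mod n)" using t by (simp add: pext_eq)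
  qed
  then show ?L by (simp add: Fstab_def)
qed

section \<open>Counting the orbits of size two\<close>

lemma cong_cong:
  "[a = a'] (mod n) \<Longrightarrow> [b = b'] (mod n) \<Longrightarrow> [a = b] (mod n) \<longleftrightarrow> [a' = b'] (mod n)"
  by (simp add: cong_def)

lemma even_cong:
  fixes r s n :: nat
  assumes "even n" "[r = s] (mod n)"
  shows "even r \<longleftrightarrow> even s"
proof -
  have "[r = s] (mod 2)" using assms cong_dvd_modulus_nat by blast
  then show ?thesis by (simp add: cong_def mod2_eq_if split: if_splits)
qed

lemma pext_congD:
  assumes "1 \<le> n" "x \<in> Sn1 n" "[pext n x s = pext n x t] (mod n)"
  shows "[s = t] (mod n)"
proof -
  have "pext n x s = pext n x t"
    using cong_imp_eq_atLeastAtMost[OF assms(3)] pext_in[OF assms(1,2)] by blast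
  moreover have "inj x" using assms(2) permutes_inj by (auto simp: Sn1_def)
  ultimately have "(cyc n ^^ s) n = (cyc n ^^ t) n" by (simp add: pext_def inj_eq)
  then show ?thesis using cyc_pow_at_n[OF assms(1), of s] cyc_pow_at_n[OF assms(1), of t]
    by (simp add: cong_def)
qed

text \<open>Turns a map of residues into a permutation: applying the power \<open>f t\<close> of the
  cycle to \<open>n\<close> selects the representative of \<open>f t\<close> in
  \<open>1..n\<close>.\<close>

definition prm_of :: "nat \<Rightarrow> (nat \<Rightarrow> nat) \<Rightarrow> prm" where
  "prm_of n f t = (if t \<in> {1..n} then (cyc n ^^ f t) n else t)"

text \<open>The equivalence assumed of \<open>f\<close> packs well-definedness and injectivity
  modulo \<open>n\<close>; on a finite set injectivity gives bijectivity, and fixing 0 means fixing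
  the point \<open>n\<close>.\<close>

lemma prm_of:
  assumes n: "1 \<le> n"
    and f: "\<And>s t. [f s = f t] (mod n) \<longleftrightarrow> [s = t] (mod n)" "[f 0 = 0] (mod n)"
  shows prm_of_Sn1: "prm_of n f \<in> Sn1 n"
    and pext_prm_of: "[pext n (prm_of n f) t = f t] (mod n)"
proof -
  have val: "[prm_of n f t = f t] (mod n)" if "t \<in> {1..n}" for t
    using that cyc_pow_at_n[OF n, of "f t"] by (simp add: prm_of_def)
  have into: "prm_of n f t \<in> {1..n}" if "t \<in> {1..n}" for t
    using that cyc_pow_in[of n n "f t"] n by (simp add: prm_of_def)
  have inj: "inj_on (prm_of n f) {1..n}"
  proof (rule inj_onI)
    fix s t assume st: "s \<in> {1..n}" "t \<in> {1..n}" "prm_of n f s = prm_of n f t"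
    then have "[f s = f t] (mod n)" using val[OF st(1)] val[OF st(2)] by (simp add: cong_def)
    then show "s = t" using f(1) st(1,2) cong_imp_eq_atLeastAtMost by blast
  qed
  have "bij_betw (prm_of n f) {1..n} {1..n}"
    unfolding bij_betw_def using inj into endo_inj_surj[of "{1..n}" "prm_of n f"] by blast
  then have "prm_of n f permutes {1..n}"
    by (rule bij_imp_permutes) (simp only: prm_of_def if_False)
  moreover have "[prm_of n f n = n] (mod n)"
  proof -
    have "[f n = f 0] (mod n)" using f(1) by (simp add: cong_def)
    then show ?thesis using val[of n] f(2) n by (simp add: cong_def)
  qed
  then have "prm_of n f n = n" using into[of n] n cong_imp_eq_atLeastAtMost by auto
  ultimately show "prm_of n f \<in> Sn1 n" by (simp add: Sn1_def)
  have t: "(cyc n ^^ t) n \<in> {1..n}" using n cyc_pow_in[of n n t] by simp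
  have "[f ((cyc n ^^ t) n) = f t] (mod n)" using f(1) cyc_pow_at_n[OF n] by blast
  then show "[pext n (prm_of n f) t = f t] (mod n)"
    unfolding pext_def using val[OF t] cong_trans by blast
qed

section \<open>Permutations whose stabilizer is generated by \<open>a^2\<close>\<close>

definition evenC :: "nat \<Rightarrow> prm set" where
  "evenC n = {(cyc n ^^ 2) ^^ k | k. True}"

text \<open>For positive even \<open>n\<close> this stabilizer has index 2, so these are the
  \<open>x\<close> whose induced irreducible modules have dimension 2.\<close>

definition Xset :: "nat \<Rightarrow> prm set" where
  "Xset n = {x \<in> Sn1 n. Fstab n x = evenC n}"

lemma evenC_pow: "(cyc n ^^ 2) ^^ k = cyc n ^^ (2 * k)"
  by (simp only: funpow_mult mult.commute)

lemma evenC_iff: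
  assumes "1 \<le> n" "even n"
  shows "cyc n ^^ r \<in> evenC n \<longleftrightarrow> even r"
proof
  assume "even r"
  then obtain k where "r = 2 * k" by blast
  then have "cyc n ^^ r = (cyc n ^^ 2) ^^ k" by (simp only: evenC_pow)
  then show "cyc n ^^ r \<in> evenC n" unfolding evenC_def by blast
next
  assume "cyc n ^^ r \<in> evenC n"
  then obtain k where "cyc n ^^ r = cyc n ^^ (2 * k)" by (auto simp: evenC_def evenC_pow)
  then have "[r = 2 * k] (mod n)"
    using cyc_pow_at_n[OF assms(1), of r] cyc_pow_at_n[OF assms(1), of "2 * k"]
    by (simp add: cong_def)
  then show "even r" using even_cong[OF assms(2)] by fastforce
qed

lemma XsetI:
  assumes "1 \<le> n" "even n" "x \<in> Sn1 n"
    and "\<And>r. (\<forall>t. [pext n x t + pext n x r = pext n x (r + t)] (mod n)) \<longleftrightarrow> even r"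
  shows "x \<in> Xset n"
proof -
  have "cyc n ^^ r \<in> Fstab n x \<longleftrightarrow> cyc n ^^ r \<in> evenC n" for r
    using Fstab_iff[OF assms(1,3)] evenC_iff[OF assms(1,2)] assms(4) by simp
  moreover have "Fstab n x \<subseteq> Cn n" "evenC n \<subseteq> Cn n"
    by (auto simp: Fstab_def evenC_def evenC_pow)
  ultimately have "Fstab n x = evenC n" by (blast elim: Cn_cases)
  with assms(3) show ?thesis by (simp add: Xset_def)
qed

lemma Xset_pext:
  assumes "1 \<le> n" "even n" "x \<in> Xset n"
  shows "(\<forall>t. [pext n x t + pext n x r = pext n x (r + t)] (mod n)) \<longleftrightarrow> even r"
  using assms Fstab_iff[OF assms(1), of x r] evenC_iff[OF assms(1,2), of r] by (simp add: Xset_def)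

text \<open>The witness fixes even residues and moves odd ones by 2. It is additive against even
  shifts; for odd \<open>r\<close> and \<open>t = 1\<close> the two sides differ by 4, which is
  nonzero modulo \<open>2m\<close> from \<open>m = 3\<close> on.\<close>

lemma Xset_nonempty:
  assumes "3 \<le> m"
  shows "Xset (2 * m) \<noteq> {}"
proof -
  let ?n = "2 * m"
  define f :: "nat \<Rightarrow> nat" where "f t = (if odd t then t + 2 else t)" for t
  have parity: "even s \<longleftrightarrow> even t" if "[s = t] (mod ?n)" for s t
    using even_cong[OF _ that] by simp
  have f: "[f s = f t] (mod ?n) \<longleftrightarrow> [s = t] (mod ?n)" for s t
  proof -
    have ev: "even (f u) \<longleftrightarrow> even u" for u by (simp add: f_def)
    show ?thesis
    proof (cases "even s \<longleftrightarrow> even t")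
      case True
      then show ?thesis using cong_add_rcancel_nat[of s 2 t ?n] by (cases "even s") (simp_all add: f_def)
    next
      case False
      then show ?thesis using parity[of s t] parity[of "f s" "f t"] ev by blast
    qed
  qed
  define x where "x = prm_of ?n f"
  have n: "1 \<le> ?n" using assms by simp
  have x: "x \<in> Sn1 ?n" "[pext ?n x t = f t] (mod ?n)" for t
    unfolding x_def using prm_of[OF n f] by (simp_all add: f_def[of 0])
  have "(\<forall>t. [pext ?n x t + pext ?n x r = pext ?n x (r + t)] (mod ?n)) \<longleftrightarrow>
      (\<forall>t. [f t + f r = f (r + t)] (mod ?n))" for r
    using cong_cong[OF cong_add[OF x(2) x(2)] x(2)] by blast
  moreover have "(\<forall>t. [f t + f r = f (r + t)] (mod ?n)) \<longleftrightarrow> even r" for r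
  proof
    assume *: "\<forall>t. [f t + f r = f (r + t)] (mod ?n)"
    show "even r"
    proof (rule ccontr)
      assume "odd r"
      then have "f 1 = 3" "f r = r + 2" "f (r + 1) = r + 1" by (simp_all add: f_def)
      then have "[3 + (r + 2) = r + 1] (mod ?n)" using *[rule_format, of 1] by simp
      moreover have "3 + (r + 2) = (r + 1) + 4" "r + 1 = (r + 1) + 0" by simp_all
      ultimately have "[(r + 1) + 4 = (r + 1) + 0] (mod ?n)" by metis
      then have "[4 = 0] (mod ?n)" by (simp only: cong_add_lcancel_nat)
      then have "?n dvd 4" by (simp add: cong_0_iff)
      then show False using assms by (auto dest: dvd_imp_le)
    qed
  qed (auto simp: f_def algebra_simps)
  ultimately have "x \<in> Xset ?n" using n x(1) by (intro XsetI) auto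
  then show ?thesis by blast
qed

text \<open>Multiplication by a unit is an automorphism of the additive group of residues, so it
  preserves and reflects the additivity conditions that describe the stabilizer.\<close>

lemma Xset_scale:
  assumes "1 \<le> n" "even n" "x \<in> Xset n" "coprime w n"
  shows "prm_of n (\<lambda>t. w * pext n x t) \<in> Xset n"
    and "[pext n (prm_of n (\<lambda>t. w * pext n x t)) t = w * pext n x t] (mod n)"
proof -
  let ?f = "\<lambda>t. w * pext n x t"
  have x: "x \<in> Sn1 n" using assms by (simp add: Xset_def)
  have cancel: "[w * u = w * v] (mod n) \<longleftrightarrow> [u = v] (mod n)" for u v
    using assms(4) by (simp add: cong_mult_lcancel_nat coprime_commute)
  have f: "[?f s = ?f t] (mod n) \<longleftrightarrow> [s = t] (mod n)" for s t
  proof -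
    have "[pext n x s = pext n x t] (mod n) \<longleftrightarrow> [s = t] (mod n)"
      using pext_congD[OF assms(1) x, of s t] pext_cong[of s t n x] by (metis cong_refl)
    then show ?thesis by (simp only: cancel)
  qed
  have f0: "[?f 0 = 0] (mod n)" using pext_0[OF x] by (simp add: cong_def)
  define y where "y = prm_of n ?f"
  have y: "y \<in> Sn1 n" "[pext n y t = ?f t] (mod n)" for t
    unfolding y_def using prm_of[OF assms(1) f f0] by simp_all
  have "[pext n y t + pext n y r = pext n y (r + t)] (mod n) \<longleftrightarrow>
      [pext n x t + pext n x r = pext n x (r + t)] (mod n)" for r t
  proof -
    have "[pext n y t + pext n y r = pext n y (r + t)] (mod n) \<longleftrightarrow> [?f t + ?f r = ?f (r + t)] (mod n)"
      using cong_cong[OF cong_add[OF y(2) y(2)] y(2)] by blast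
    then show ?thesis using cancel[of "pext n x t + pext n x r" "pext n x (r + t)"]
      by (simp add: algebra_simps)
  qed
  then have "y \<in> Xset n" using XsetI[OF assms(1,2) y(1)] Xset_pext[OF assms(1,2,3)] by simp
  then show "prm_of n ?f \<in> Xset n" by (simp add: y_def)
  show "[pext n (prm_of n ?f) t = ?f t] (mod n)" using y(2) by (simp add: y_def)
qed

section \<open>Slopes of a permutation and of its inverse\<close>

lemma Xset_slope:
  assumes "1 \<le> n" "even n" "x \<in> Xset n"
  shows "[pext n x (t + 2) = pext n x t + x 2] (mod n)"
proof -
  have "[pext n x t + pext n x 2 = pext n x (2 + t)] (mod n)"
    using Xset_pext[OF assms, of 2] by simp
  moreover have "pext n x 2 = x 2" using assms by (intro pext_eq) auto
  ultimately show ?thesis by (simp add: cong_def add.commute)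
qed

text \<open>Moving along an orbit shifts the argument and subtracts a constant, so increments over
  distance 2 stay the same.\<close>

lemma orbit_slope:
  assumes "1 \<le> n" "even n" "x \<in> Xset n" "z \<in> Sn1 n" "c \<in> Cn n" "ract n z c = x"
  shows "[pext n z (t + 2) = pext n z t + x 2] (mod n)"
proof -
  obtain r where r: "c = cyc n ^^ r" using assms(5) by (rule Cn_cases)
  have shift: "[pext n x u + pext n z r = pext n z (r + u)] (mod n)" for u
    using pext_ract[OF assms(1,4), of r u] assms(6) r by simp
  \<comment> \<open>\<open>u\<close> represents \<open>t - r\<close> modulo \<open>n\<close>, since
    \<open>n - 1\<close> represents -1.\<close>
  define u where "u = t + (n - 1) * r"
  have "r + u = t + n * r" using assms(1) by (cases n) (simp_all add: u_def)
  then have ru: "[r + u = t] (mod n)" by (simp add: cong_def)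
  then have ru2: "[r + (u + 2) = t + 2] (mod n)"
    using cong_add_rcancel_nat[of "r + u" 2 t n] by (simp only: add.assoc)
  have "[pext n z (t + 2) = pext n x (u + 2) + pext n z r] (mod n)"
    using shift[of "u + 2"] pext_cong[OF ru2] by (simp only: cong_def)
  moreover have "[pext n x (u + 2) + pext n z r = (pext n x u + x 2) + pext n z r] (mod n)"
    using Xset_slope[OF assms(1-3)] by (rule cong_add) simp
  moreover have "[(pext n x u + pext n z r) + x 2 = pext n z t + x 2] (mod n)"
    using shift[of u] pext_cong[OF ru, of z] by (intro cong_add) simp_all
  ultimately show ?thesis by (simp only: cong_def ac_simps)
qed

text \<open>On even residues \<open>z\<close> is linear, \<open>z(2k) = ks\<close>. The inverse
  sends 2 to \<open>s = 2u\<close>, so \<open>2 = z(2u) = us\<close> modulo \<open>2m\<close>, which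
  is the claim after doubling.\<close>

lemma slope_square:
  assumes n: "n = 2 * m" "1 \<le> m" and z: "z \<in> Sn1 n"
    and s: "\<And>t. [pext n z (t + 2) = pext n z t + s] (mod n)"
    and s': "\<And>t. [pext n (inv_into UNIV z) (t + 2) = pext n (inv_into UNIV z) t + s] (mod n)"
  shows "[s\<^sup>2 = 4] (mod 4 * m)"
proof -
  have n1: "1 \<le> n" using n by simp
  have zk: "[pext n z (2 * k) = k * s] (mod n)" for k
  proof (induction k)
    case 0
    show ?case using pext_0[OF z] by (simp add: cong_def)
  next
    case (Suc k)
    have "[pext n z (2 * k + 2) = pext n z (2 * k) + s] (mod n)" by (rule s)
    also have "[pext n z (2 * k) + s = k * s + s] (mod n)" using Suc by (intro cong_add) simp_all
    finally show ?case by (simp add: algebra_simps)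
  qed
  \<comment> \<open>At \<open>k = m\<close> the argument \<open>2m\<close> wraps around to 0; this
    forces \<open>s\<close> to be even.\<close>
  have "[m * s = 0] (mod 2 * m)"
    using zk[of m] pext_cong[of n 0 n z] pext_0[OF z] n by (simp add: cong_def)
  then have "m * 2 dvd m * s" by (simp add: cong_0_iff mult.commute)
  then have "even s" using n(2) by simp
  then obtain u where u: "s = 2 * u" by blast
  let ?y = "inv_into UNIV z"
  have y: "?y \<in> Sn1 n" using z by simp
  define q where "q = pext n ?y 2"
  have q: "q \<in> {1..n}" unfolding q_def using n1 y by (rule pext_in)
  have "[q = s] (mod n)"
    using s'[of 0] pext_0[OF y] by (simp add: q_def cong_def numeral_2_eq_2)
  then have "pext n z q = pext n z (2 * u)" using u by (auto intro: pext_cong)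
  moreover have zy: "z (?y t) = t" for t
    using z permutes_inverses(1)[of z "{1..n}" t] by (simp only: Sn1_def mem_Collect_eq)
  have "pext n z q = (cyc n ^^ 2) n"
    using pext_eq[OF q, of z] zy[of "(cyc n ^^ 2) n"] by (simp only: q_def pext_def[of n ?y])
  ultimately have "[2 = u * s] (mod n)"
    using zk[of u] cyc_pow_at_n[OF n1, of 2] by (simp add: cong_def)
  then have "[u * s = 2] (mod 2 * m)" using n cong_sym by blast
  \<comment> \<open>Doubling both sides doubles the modulus as well, and \<open>2us\<close> is the
    square of \<open>s\<close>.\<close>
  then have "[2 * (u * s) = 2 * 2] (mod 2 * (2 * m))" 
    by (simp only: cong_def mod_mult_mult1)
  then show ?thesis using u by (simp add: power2_eq_square algebra_simps)
qed

text \<open>Writing \<open>x 2 = 2 u\<close>, the condition says \<open>u\<^sup>2 = 1\<close> modulo \<open>m\<close>.\<close>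

definition Xinv :: "nat \<Rightarrow> prm set" where
  "Xinv m = {x \<in> Xset (2 * m). [(x 2)\<^sup>2 = 4] (mod 4 * m)}"

text \<open>Both \<open>z\<close> and its inverse lie in the orbit of \<open>x\<close>, so by
  \<open>orbit_slope\<close> they share the slope \<open>x 2\<close>.\<close>

lemma Xinv_if_self_inverse_orbit:
  assumes "1 \<le> m" "x \<in> Xset (2 * m)" "z \<in> Sn1 (2 * m)" "b \<in> Cn (2 * m)" "c \<in> Cn (2 * m)"
    and "ract (2 * m) z b = x" "ract (2 * m) (inv_into UNIV z) c = x"
  shows "x \<in> Xinv m"
proof -
  have "[(x 2)\<^sup>2 = 4] (mod 4 * m)"
    using assms by (intro slope_square[OF refl assms(1,3)] orbit_slope[where c = b] orbit_slope[where c = c]) auto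
  then show ?thesis using assms(2) by (simp add: Xinv_def)
qed

section \<open>Disjoint translates by units\<close>

lemma cong_square_double:
  fixes a b m :: nat
  assumes "[a = b] (mod 2 * m)"
  shows "[a\<^sup>2 = b\<^sup>2] (mod 4 * m)"
proof -
  \<comment> \<open>The quotient \<open>k\<close> may be negative, hence the integers. With
    \<open>a = b + 2mk\<close> the cross term of the square gains a second factor 2, which lifts the
    modulus to \<open>4m\<close>.\<close>
  have "[int a = int b] (mod int (2 * m))" using assms by (simp only: cong_int_iff)
  then have "int (2 * m) dvd int a - int b" by (simp only: cong_iff_dvd_diff)
  then obtain k where "int a - int b = int (2 * m) * k" by (rule dvdE)
  then have k: "int a = int b + 2 * int m * k" by simp
  have "(int a)\<^sup>2 - (int b)\<^sup>2 = int (4 * m) * (k * int b + int m * k * k)"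
    unfolding k by (simp add: power2_eq_square algebra_simps)
  then have "int (4 * m) dvd int (a\<^sup>2) - int (b\<^sup>2)" by simp
  then show ?thesis by (simp only: cong_int_iff flip: cong_iff_dvd_diff)
qed

text \<open>Scaling by \<open>w\<close> multiplies the slope by \<open>w\<close>. On
  \<open>Xinv\<close> the slope has square 4, so the scaled permutation determines
  \<open>4w^2\<close> modulo \<open>4m\<close>, hence \<open>w^2\<close> modulo \<open>m\<close>,
  hence \<open>w\<close>; cancelling \<open>w\<close> then recovers the original
  permutation.\<close>

lemma card_Xinv_le:
  assumes "1 \<le> m" "finite W" "\<And>w. w \<in> W \<Longrightarrow> coprime w (2 * m)"
    and W: "\<And>v w. v \<in> W \<Longrightarrow> w \<in> W \<Longrightarrow> [v\<^sup>2 = w\<^sup>2] (mod m) \<Longrightarrow> v = w"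
  shows "card W * card (Xinv m) \<le> card (Xset (2 * m))"
proof -
  let ?n = "2 * m"
  define S where "S = (\<lambda>(w, x). prm_of ?n (\<lambda>t. w * pext ?n x t))"
  have n: "1 \<le> ?n" using assms(1) by simp
  have inj: "inj_on S (W \<times> Xinv m)"
  proof (rule inj_onI, safe)
    fix v x w y
    assume A: "v \<in> W" "x \<in> Xinv m" "w \<in> W" "y \<in> Xinv m" "S (v, x) = S (w, y)"
    have X: "x \<in> Xset ?n" "y \<in> Xset ?n" using A by (auto simp: Xinv_def)
    have *: "[v * pext ?n x t = w * pext ?n y t] (mod ?n)" for t
      using Xset_scale(2)[OF n _ X(1), of v t] Xset_scale(2)[OF n _ X(2), of w t] A assms(3)
      by (simp add: S_def cong_def)
    have "pext ?n x 2 = x 2" "pext ?n y 2 = y 2" using assms(1) by (auto intro!: pext_eq)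
    then have "[(v * x 2)\<^sup>2 = (w * y 2)\<^sup>2] (mod 4 * m)" using *[of 2] by (intro cong_square_double) simp
    moreover have "[v\<^sup>2 * (x 2)\<^sup>2 = v\<^sup>2 * 4] (mod 4 * m)" "[w\<^sup>2 * (y 2)\<^sup>2 = w\<^sup>2 * 4] (mod 4 * m)"
      using A by (auto simp: Xinv_def intro: cong_mult)
    ultimately have "[4 * v\<^sup>2 = 4 * w\<^sup>2] (mod 4 * m)"
      by (simp add: cong_def power_mult_distrib mult.commute)
    then have "[v\<^sup>2 = w\<^sup>2] (mod m)" by (simp add: cong_def)
    then show vw: "v = w" using W A by blast
    have c: "coprime w ?n" using assms(3) A by blast
    show "x = y"
    proof (rule Sn1_eqI)
      show "x \<in> Sn1 ?n" "y \<in> Sn1 ?n" using X by (auto simp: Xset_def)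
      fix t assume t: "t \<in> {1..?n}"
      have "[pext ?n x t = pext ?n y t] (mod ?n)"
        using *[of t] vw cong_mult_lcancel_nat[OF c] by simp
      then show "[x t = y t] (mod ?n)" using t by (simp add: pext_eq)
    qed
  qed
  have "S ` (W \<times> Xinv m) \<subseteq> Xset ?n"
    using Xset_scale(1)[OF n] assms(3) by (auto simp: S_def Xinv_def)
  moreover have "finite (Xset ?n)" by (simp add: Xset_def)
  ultimately have "card (S ` (W \<times> Xinv m)) \<le> card (Xset ?n)" by (intro card_mono)
  then show ?thesis using card_image[OF inj] by (simp add: card_cartesian_product)
qed

text \<open>The set consists of powers of a unit \<open>w\<close> with residue 3 at the 2-part of
  \<open>m\<close> and residue 2 at its odd part. One of the two parts is at least
  \<open>9^K\<close>, and modulo that part the squares become powers of 9 or of 4 that are too small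
  to coincide.\<close>

lemma exists_distinct_squares:
  fixes K m :: nat
  assumes "81 ^ K \<le> m"
  shows "\<exists>W :: nat set. finite W \<and> card W = K \<and> (\<forall>w\<in>W. coprime w (2 * m)) \<and>
    (\<forall>v\<in>W. \<forall>w\<in>W. [v\<^sup>2 = w\<^sup>2] (mod m) \<longrightarrow> v = w)"
proof -
  have m: "m \<noteq> 0" using assms by (cases m) auto
  obtain a b where ab: "m = 2 ^ a * b" "odd b"
    using multiplicity_decompose'[of m 2] m by (metis odd_one)
  \<comment> \<open>The exponent \<open>Suc a\<close> makes \<open>w\<close> odd even when
    \<open>m\<close> is odd, as coprimality to \<open>2m\<close> requires.\<close>
  have "coprime (2 ^ Suc a) b" using ab(2) by simp
  then obtain w :: nat where w: "[w = 3] (mod 2 ^ Suc a)" "[w = 2] (mod b)"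
    using binary_chinese_remainder_nat by blast
  have w3: "[w = 3] (mod 2 ^ a)" using w(1) by (rule cong_dvd_modulus_nat) simp
  have "[w = 3] (mod 2)" using w(1) by (rule cong_dvd_modulus_nat) simp
  then have "odd w" by (simp add: cong_def odd_iff_mod_2_eq_one)
  moreover have "coprime w b" using w(2) ab(2) cong_imp_coprime[OF cong_sym[OF w(2)]] by simp
  ultimately have cop: "coprime w (2 * m)" by (simp add: ab(1))
  have large: "9 ^ K \<le> (2::nat) ^ a \<or> 9 ^ K \<le> b"
  proof (rule ccontr)
    assume "\<not> ?thesis"
    then have "2 ^ a * b < 9 ^ K * 9 ^ K" by (intro mult_strict_mono) auto
    then show False using assms ab(1) by (simp flip: power_mult_distrib)
  qed
  have dist: "i = j" if "i < K" "j < K" "[(w ^ i)\<^sup>2 = (w ^ j)\<^sup>2] (mod m)" for i j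
  proof -
    \<comment> \<open>Modulo a divisor \<open>d\<close> of \<open>m\<close>, \<open>w\<close> is
      replaced by its small residue \<open>g\<close>.\<close>
    have red: "[(g\<^sup>2) ^ i = (g\<^sup>2) ^ j] (mod d)" if "d dvd m" "[w = g] (mod d)" for g d
    proof -
      have "[(w ^ i)\<^sup>2 = (w ^ j)\<^sup>2] (mod d)"
        using cong_dvd_modulus_nat \<open>[(w ^ i)\<^sup>2 = (w ^ j)\<^sup>2] (mod m)\<close> that(1) by blast
      moreover have "[(w ^ e)\<^sup>2 = (g\<^sup>2) ^ e] (mod d)" for e
        using cong_pow[OF that(2), of "e * 2"] by (simp add: mult.commute flip: power_mult)
      ultimately show ?thesis by (simp only: cong_def)
    qed
    \<comment> \<open>For exponents below \<open>K\<close> the powers of \<open>h\<close> stay below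
      \<open>d\<close>, so their congruence is equality of integers.\<close>
    have eq: "i = j" if "9 ^ K \<le> d" "[h ^ i = h ^ j] (mod d)" "1 < h" "h \<le> 9" for d h :: nat
    proof -
      have "h ^ e < d" if "e < K" for e
      proof -
        have "h ^ e \<le> 9 ^ e" using \<open>h \<le> 9\<close> by (simp add: power_mono)
        also have "(9::nat) ^ e < 9 ^ K" using that by simp
        finally show ?thesis using \<open>9 ^ K \<le> d\<close> by simp
      qed
      then have "h ^ i = h ^ j"
        using cong_less_modulus_unique_nat[OF that(2)] \<open>i < K\<close> \<open>j < K\<close> by blast
      then show ?thesis using \<open>1 < h\<close> by simp
    qed
    from large show ?thesis
    proof
      assume "9 ^ K \<le> (2::nat) ^ a"
      then show ?thesis using eq[of "2 ^ a" "3\<^sup>2"] red[of "2 ^ a" 3] w3 ab(1) by simp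
    next
      assume "9 ^ K \<le> b"
      then show ?thesis using eq[of b "2\<^sup>2"] red[of b 2] w(2) ab(1) by simp
    qed
  qed
  define W where "W = (\<lambda>i. w ^ i) ` {..<K}"
  have "inj_on (\<lambda>i. w ^ i) {..<K}" using dist by (intro inj_onI) simp
  then have "card W = K" by (simp add: W_def card_image)
  moreover have "\<forall>v\<in>W. \<forall>w\<in>W. [v\<^sup>2 = w\<^sup>2] (mod m) \<longrightarrow> v = w" using dist by (auto simp: W_def)
  moreover have "\<forall>v\<in>W. coprime v (2 * m)" using cop unfolding W_def by simp
  ultimately show ?thesis by (intro exI[of _ W]) (simp add: W_def)
qed

section \<open>The integral and the support of its square\<close>

lemma Jbas_Jcar:
  assumes "y \<in> Sn1 n" "b \<in> Cn n"
  shows "Jbas y b \<in> Jcar n"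
  using assms by (auto simp: Jcar_def Jbas_def Jidx_def)

lemma finite_Jidx [simp]: "finite (Jidx n)"
  by (simp add: Jidx_def)

lemma sum_Jidx: "(\<Sum>u\<in>Jidx n. k u) = (\<Sum>y\<in>Sn1 n. \<Sum>b\<in>Cn n. k (y, b))"
  unfolding Jidx_def by (simp add: sum.cartesian_product)

lemma Jmult_bas_apply:
  "Jmult_bas n (y', b) (z, c) (y, d) = (if z = ract n y' b \<and> y' = y \<and> b \<circ> c = d then 1 else 0)"
  by (auto simp: Jmult_bas_def Jbas_def)

lemma Jmu_Jcar:
  assumes "1 \<le> n"
  shows "Jmu n T \<in> Jcar n"
  unfolding Jcar_def
proof (intro CollectI allI impI)
  fix w assume w: "w \<notin> Jidx n"
  have "Jmult_bas n u v w = 0" if "u \<in> Jidx n" "v \<in> Jidx n" for u v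
  proof -
    obtain y b z c d e where "u = (y, b)" "v = (z, c)" "w = (d, e)" by (metis surj_pair)
    then show ?thesis using that w by (auto simp: Jmult_bas_apply Jidx_def)
  qed
  then show "Jmu n T w = 0" by (simp add: Jmu_def)
qed

text \<open>The deltas in the product force the left index to be \<open>y\<close> and the right one
  to be \<open>ract n y b\<close>; only the factorizations of \<open>d\<close> remain to be
  summed.\<close>

lemma Jmult_apply:
  assumes n: "1 \<le> n" and y: "y \<in> Sn1 n"
  shows "Jmult n f g (y, d) =
    (\<Sum>b\<in>Cn n. \<Sum>c\<in>Cn n. if b \<circ> c = d then f (y, b) * g (ract n y b, c) else 0)"
proof -
  have "Jmult n f g (y, d) = (\<Sum>y'\<in>Sn1 n. \<Sum>b\<in>Cn n. \<Sum>z\<in>Sn1 n. \<Sum>c\<in>Cn n.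
      f (y', b) * g (z, c) * Jmult_bas n (y', b) (z, c) (y, d))"
    by (simp add: Jmult_def Jmu_def tens_def sum_Jidx)
  also have "\<dots> = (\<Sum>y'\<in>Sn1 n. if y' = y then \<Sum>b\<in>Cn n. \<Sum>z\<in>Sn1 n. if z = ract n y b
      then \<Sum>c\<in>Cn n. if b \<circ> c = d then f (y, b) * g (z, c) else 0 else 0 else 0)"
  proof (intro sum.cong refl)
    fix y' assume "y' \<in> Sn1 n"
    have "(\<Sum>c\<in>Cn n. f (y', b) * g (z, c) * Jmult_bas n (y', b) (z, c) (y, d)) =
        (if y' = y then if z = ract n y b
          then \<Sum>c\<in>Cn n. if b \<circ> c = d then f (y, b) * g (z, c) else 0 else 0 else 0)" for b z
      by (auto simp: Jmult_bas_apply intro!: sum.cong)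
    then show "(\<Sum>b\<in>Cn n. \<Sum>z\<in>Sn1 n. \<Sum>c\<in>Cn n.
        f (y', b) * g (z, c) * Jmult_bas n (y', b) (z, c) (y, d)) =
      (if y' = y then \<Sum>b\<in>Cn n. \<Sum>z\<in>Sn1 n. if z = ract n y b
        then \<Sum>c\<in>Cn n. if b \<circ> c = d then f (y, b) * g (z, c) else 0 else 0 else 0)"
      by simp
  qed
  also have "\<dots> = (\<Sum>b\<in>Cn n. \<Sum>z\<in>Sn1 n. if z = ract n y b
      then \<Sum>c\<in>Cn n. if b \<circ> c = d then f (y, b) * g (z, c) else 0 else 0)"
    using y by (simp add: sum.delta)
  also have "\<dots> = (\<Sum>b\<in>Cn n. \<Sum>c\<in>Cn n. if b \<circ> c = d then f (y, b) * g (ract n y b, c) else 0)"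
    using n y by (intro sum.cong[OF refl, of "Cn n"]) (simp add: sum.delta)
  finally show ?thesis .
qed

text \<open>In a group the equation has exactly one solution \<open>c\<close>.\<close>

lemma sum_Cn_comp:
  assumes "b \<in> Cn n" "d \<in> Cn n"
  shows "(\<Sum>c\<in>Cn n. if b \<circ> c = d then k else (0::complex)) = k"
    and "(\<Sum>c\<in>Cn n. if c \<circ> b = d then k else (0::complex)) = k"
proof -
  obtain e where e: "e \<in> Cn n" "e \<circ> b = id" "b \<circ> e = id" using Cn_inverse[OF assms(1)] .
  have 1: "b \<circ> c = d \<longleftrightarrow> c = e \<circ> d" for c
    using e(2,3) by (metis comp_assoc id_comp)
  have ed: "e \<circ> d \<in> Cn n" using e assms by simp
  show *: "(\<Sum>c\<in>Cn n. if b \<circ> c = d then k else (0::complex)) = k"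
    using ed by (simp add: 1 sum.delta)
  have "(\<Sum>c\<in>Cn n. if c \<circ> b = d then k else 0) = (\<Sum>c\<in>Cn n. if b \<circ> c = d then k else 0)"
    using Cn_commute[OF assms(1)] by (intro sum.cong) auto
  with * show "(\<Sum>c\<in>Cn n. if c \<circ> b = d then k else 0) = k" by simp
qed

section \<open>The normalized integral\<close>

lemma Jcounit_eq: "Jcounit n f = (\<Sum>b\<in>Cn n. f (id, b))"
proof -
  have "Jcounit n f = (\<Sum>y\<in>Sn1 n. if y = id then \<Sum>b\<in>Cn n. f (y, b) else 0)"
    unfolding Jcounit_def sum_Jidx by (intro sum.cong refl) (auto intro: sum.neutral)
  then show ?thesis by (simp add: sum.delta)
qed

text \<open>The integral in closed form: \<open>p_1 # e\<close>, where \<open>e\<close> is the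
  average of the elements of \<open>Cn\<close>.\<close>

definition Jint :: "nat \<Rightarrow> jelt" where
  "Jint n = (\<lambda>(y, b). if y = id \<and> b \<in> Cn n then 1 / of_nat (card (Cn n)) else 0)"

text \<open>The identity is a fixed point of the action, hence alone in its orbit.\<close>

lemma ract_eq_id_iff:
  assumes "1 \<le> n" "y \<in> Sn1 n" "b \<in> Cn n"
  shows "ract n y b = id \<longleftrightarrow> y = id"
proof
  assume *: "ract n y b = id"
  obtain e where e: "e \<in> Cn n" "e \<circ> b = id" "b \<circ> e = id" using Cn_inverse[OF assms(3)] .
  show "y = id" using ract_cancel[OF assms(1,2) id_Sn1 assms(3) e(1,3) *] assms(1) e(1) by simp
qed (use assms in simp)

lemma Jcar_eqI:
  assumes "f \<in> Jcar n" "g \<in> Jcar n" "\<And>y d. y \<in> Sn1 n \<Longrightarrow> d \<in> Cn n \<Longrightarrow> f (y, d) = g (y, d)"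
  shows "f = g"
proof
  fix w show "f w = g w"
    using assms by (cases w; cases "w \<in> Jidx n") (auto simp: Jcar_def Jidx_def)
qed

text \<open>The factor \<open>p_1\<close> keeps only the terms at \<open>id\<close>, which is alone
  in its orbit, and averaging over \<open>Cn\<close> absorbs the group element. What is left of
  \<open>h\<close> is its counit.\<close>

lemma Jint_props:
  assumes n: "1 \<le> n"
  shows "Jint n \<in> Jcar n" "Jcounit n (Jint n) = 1"
    and "h \<in> Jcar n \<Longrightarrow> Jmult n h (Jint n) = (\<lambda>w. Jcounit n h * Jint n w)"
    and "h \<in> Jcar n \<Longrightarrow> Jmult n (Jint n) h = (\<lambda>w. Jcounit n h * Jint n w)"
proof -
  show car: "Jint n \<in> Jcar n" by (auto simp: Jint_def Jcar_def Jidx_def)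
  have "card (Cn n) \<noteq> 0" using id_Cn[of n] by (auto simp: card_eq_0_iff simp del: id_Cn)
  then show "Jcounit n (Jint n) = 1" by (simp add: Jcounit_eq Jint_def)
  let ?k = "1 / of_nat (card (Cn n)) :: complex"
  assume h: "h \<in> Jcar n"
  have rhs: "(\<lambda>w. Jcounit n h * Jint n w) \<in> Jcar n" using car by (auto simp: Jcar_def)
  have mult: "Jmult n f g \<in> Jcar n" for f g using n by (simp add: Jmult_def Jmu_Jcar)
  show "Jmult n h (Jint n) = (\<lambda>w. Jcounit n h * Jint n w)"
  proof (rule Jcar_eqI[OF mult rhs])
    fix y d assume y: "y \<in> Sn1 n" "d \<in> Cn n"
    have "Jmult n h (Jint n) (y, d) =
        (\<Sum>b\<in>Cn n. \<Sum>c\<in>Cn n. if b \<circ> c = d then (if y = id then h (id, b) * ?k else 0) else 0)"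
      unfolding Jmult_apply[OF n y(1)] using n y
      by (intro sum.cong refl) (simp add: Jint_def ract_eq_id_iff)
    also have "\<dots> = (\<Sum>b\<in>Cn n. if y = id then h (id, b) * ?k else 0)"
      using y by (intro sum.cong refl sum_Cn_comp(1)) auto
    finally show "Jmult n h (Jint n) (y, d) = Jcounit n h * Jint n (y, d)"
      using y by (simp add: Jcounit_eq Jint_def sum_divide_distrib)
  qed
  show "Jmult n (Jint n) h = (\<lambda>w. Jcounit n h * Jint n w)"
  proof (rule Jcar_eqI[OF mult rhs])
    fix y d assume y: "y \<in> Sn1 n" "d \<in> Cn n"
    have "Jmult n (Jint n) h (y, d) =
        (\<Sum>b\<in>Cn n. \<Sum>c\<in>Cn n. if b \<circ> c = d then (if y = id then h (id, c) * ?k else 0) else 0)"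
      unfolding Jmult_apply[OF n y(1)] using n y
      by (intro sum.cong refl) (simp add: Jint_def)
    also have "\<dots> = (\<Sum>c\<in>Cn n. \<Sum>b\<in>Cn n. if b \<circ> c = d then (if y = id then h (id, c) * ?k else 0) else 0)"
      by (rule sum.swap)
    also have "\<dots> = (\<Sum>c\<in>Cn n. if y = id then h (id, c) * ?k else 0)"
      using y by (intro sum.cong refl sum_Cn_comp(2)) auto
    finally show "Jmult n (Jint n) h (y, d) = Jcounit n h * Jint n (y, d)"
      using y by (simp add: Jcounit_eq Jint_def sum_divide_distrib)
  qed
qed

text \<open>Uniqueness: the product of two normalized two-sided integrals equals each of
  them.\<close>

lemma Jintegral_eq:
  assumes n: "1 \<le> n"
  shows "Jintegral n = Jint n"
  unfolding Jintegral_def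
proof (rule the_equality)
  show "Jint n \<in> Jcar n \<and> Jcounit n (Jint n) = 1 \<and>
     (\<forall>h\<in>Jcar n. Jmult n h (Jint n) = (\<lambda>w. Jcounit n h * Jint n w) \<and>
                 Jmult n (Jint n) h = (\<lambda>w. Jcounit n h * Jint n w))"
    using Jint_props[OF n] by blast
next
  fix L
  assume L: "L \<in> Jcar n \<and> Jcounit n L = 1 \<and>
     (\<forall>h\<in>Jcar n. Jmult n h L = (\<lambda>w. Jcounit n h * L w) \<and> Jmult n L h = (\<lambda>w. Jcounit n h * L w))"
  have "Jmult n L (Jint n) = L" using L Jint_props(1,2)[OF n] by simp
  moreover have "Jmult n L (Jint n) = Jint n" using L Jint_props(3)[OF n, of L] by simp
  ultimately show "L = Jint n" by simp
qed

text \<open>The identity \<open>\<Lambda>\<^sub>1\<Lambda>\<^sub>2 = (1/n) \<Sum>\<^sub>b \<Sum>\<^sub>z (p\<^bsub>inv z\<^esub> # (z \<rhd> b))(p\<^sub>z # b)\<close> localizes the support.\<close>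

lemma FS_element_support:
  assumes n: "1 \<le> n" and "Jmu n (Jcomult n (Jintegral n)) (y, g) \<noteq> 0"
  shows "y \<in> Sn1 n" "\<exists>b\<in>Cn n. ract n y b = inv_into UNIV y"
proof -
  let ?L = "Jintegral n"
  have "\<exists>u\<in>Jidx n. \<exists>v\<in>Jidx n. Jcomult n ?L (u, v) * Jmult_bas n u v (y, g) \<noteq> 0"
    using assms(2) unfolding Jmu_def by (metis (no_types, lifting) sum.neutral)
  then obtain u v where uv: "Jcomult n ?L (u, v) \<noteq> 0" "Jmult_bas n u v (y, g) \<noteq> 0" by auto
  from uv(1) have "\<exists>w\<in>Jidx n. (case w of (y, b) \<Rightarrow> ?L (y, b) *
      (\<Sum>z\<in>Sn1 n. tens (Jbas (y \<circ> inv_into UNIV z) (lact n z b)) (Jbas z b) (u, v))) \<noteq> 0"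
    unfolding Jcomult_def by (metis (no_types, lifting) sum.neutral)
  then obtain x b where xb: "?L (x, b) \<noteq> 0"
    "(\<Sum>z\<in>Sn1 n. tens (Jbas (x \<circ> inv_into UNIV z) (lact n z b)) (Jbas z b) (u, v)) \<noteq> 0" by auto
  from xb(2) obtain z where z: "z \<in> Sn1 n"
    "tens (Jbas (x \<circ> inv_into UNIV z) (lact n z b)) (Jbas z b) (u, v) \<noteq> 0"
    by (metis (no_types, lifting) sum.neutral)
  have "x = id" using xb(1) n by (auto simp: Jintegral_eq Jint_def split: if_splits)
  then have "u = (inv_into UNIV z, lact n z b)" "v = (z, b)"
    using z(2) by (auto simp: tens_def Jbas_def split: if_splits)
  \<comment> \<open>The product of the two basis elements is nonzero only if \<open>z\<close> is the
    image of its own inverse under the action; that inverse is \<open>y\<close>.\<close>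
  with uv(2) have y: "z = ract n y (lact n z b)" "y = inv_into UNIV z"
    by (auto simp: Jmult_bas_apply split: if_splits)
  show "y \<in> Sn1 n" using y z by simp
  have "inv_into UNIV y = z" unfolding y(2) using z(1) permutes_inv_inv by (auto simp: Sn1_def)
  then show "\<exists>b\<in>Cn n. ract n y b = inv_into UNIV y" using y(1) lact_Cn by metis
qed

section \<open>Vanishing of the indicator\<close>

lemma is_Jmodule_eq_0:
  assumes R: "is_Jmodule n d R" and "finite A" "A \<subseteq> Jidx n"
    and 0: "\<And>y b. (y, b) \<in> A \<Longrightarrow> R (Jbas y b) = 0\<^sub>m d d"
    and f: "\<And>u. u \<notin> A \<Longrightarrow> f u = 0"
  shows "R f = 0\<^sub>m d d"
  using assms(2,3) 0 f
proof (induction A arbitrary: f)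
  case empty
  have z: "(\<lambda>_. 0) \<in> Jcar n" by (simp add: Jcar_def)
  \<comment> \<open>Writing the zero element as 0 times itself lets homogeneity compute its
    image.\<close>
  have "R (\<lambda>w. 0 * (0::complex)) = 0 \<cdot>\<^sub>m R (\<lambda>_. 0)" "R (\<lambda>_. 0) \<in> carrier_mat d d"
    using R z by (simp_all only: is_Jmodule_def)
  moreover have "f = (\<lambda>_. 0)" using empty by auto
  moreover have "0 \<cdot>\<^sub>m A = 0\<^sub>m d d" if "A \<in> carrier_mat d d" for A :: "complex mat"
    using that by (intro eq_matI) auto
  ultimately show ?case by simp
next
  case (insert u A)
  obtain y b where u: "u = (y, b)" by fastforce
  \<comment> \<open>Splitting off the coefficient at \<open>u\<close> leaves an element supported on
    \<open>A\<close>, to which the induction hypothesis applies.\<close>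
  define g where "g = f(u := 0)"
  have Jb: "Jbas y b \<in> Jcar n" using insert.prems(1) u by (intro Jbas_Jcar) (auto simp: Jidx_def)
  have g: "R g = 0\<^sub>m d d" 
  proof (rule insert.IH)
    show "A \<subseteq> Jidx n" using insert.prems(1) by simp
    show "R (Jbas y b) = 0\<^sub>m d d" if "(y, b) \<in> A" for y b using insert.prems(2) that by simp
    show "g v = 0" if "v \<notin> A" for v using insert.prems(3)[of v] that by (simp add: g_def)
  qed
  have gc: "g \<in> Jcar n" 
    using insert.prems(1,3) by (auto simp: g_def Jcar_def simp del: split_paired_All)
  have sc: "(\<lambda>w. f u * Jbas y b w) \<in> Jcar n" using Jb by (simp add: Jcar_def)
  have "f = (\<lambda>w. g w + f u * Jbas y b w)" by (auto simp: g_def u Jbas_def)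
  then have "R f = R (\<lambda>w. g w + f u * Jbas y b w)" by simp
  also have "\<dots> = R g + R (\<lambda>w. f u * Jbas y b w)" using R gc sc by (simp add: is_Jmodule_def)
  also have "R (\<lambda>w. f u * Jbas y b w) = f u \<cdot>\<^sub>m R (Jbas y b)" using R Jb by (simp add: is_Jmodule_def)
  also have "R (Jbas y b) = 0\<^sub>m d d" using insert.prems u by simp
  finally show ?case using g by simp
qed

lemma mult_mat_vec_0_imp:
  fixes A :: "'a :: semiring_1 mat"
  assumes A: "A \<in> carrier_mat r k" and 0: "\<And>v. v \<in> carrier_vec k \<Longrightarrow> A *\<^sub>v v = 0\<^sub>v r"
  shows "A = 0\<^sub>m r k"
proof (rule eq_matI)
  fix i j assume ij: "i < dim_row (0\<^sub>m r k :: 'a mat)" "j < dim_col (0\<^sub>m r k :: 'a mat)"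
  have "A $$ (i, j) = (A *\<^sub>v unit_vec k j) $ i"
    using A ij by (simp add: scalar_prod_right_unit)
  then show "A $$ (i, j) = 0\<^sub>m r k $$ (i, j)" using 0[of "unit_vec k j"] ij by simp
qed (use A in auto)

text \<open>The operator kills every \<open>c \<otimes> v\<close>, so it and the zero matrix both
  factor the zero balanced family; uniqueness in the universal property makes them equal.\<close>

lemma induced_vanishes_off_orbit:
  assumes ind: "is_induced n x k \<rho> d R" and rep: "is_rep (Fstab n x) k \<rho>"
    and y: "y \<in> Sn1 n" "b \<in> Cn n" and off: "\<And>c. c \<in> Cn n \<Longrightarrow> ract n y c \<noteq> x"
  shows "R (Jbas y b) = 0\<^sub>m d d"
proof -
  let ?F = "Fstab n x" and ?M = "R (Jbas y b)"
  obtain P where P: "is_tensor n ?F k \<rho> d P"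
    and act: "\<And>c v. c \<in> Cn n \<Longrightarrow> v \<in> carrier_vec k \<Longrightarrow> ?M *\<^sub>v (P c *\<^sub>v v) =
             (if ract n y (b \<circ> c) = x then P (b \<circ> c) *\<^sub>v v else 0\<^sub>v d)"
    using ind y unfolding is_induced_def by blast
  have M: "?M \<in> carrier_mat d d"
    using ind Jbas_Jcar[OF y] unfolding is_induced_def is_Jmodule_def by blast
  have Pc: "P c \<in> carrier_mat d k" if "c \<in> Cn n" for c
    using P that unfolding is_tensor_def balanced_def by blast
  have "?M * P c = 0\<^sub>m d k" if c: "c \<in> Cn n" for c
  proof (rule mult_mat_vec_0_imp)
    show "?M * P c \<in> carrier_mat d k" using M Pc[OF c] by simp
    fix v :: "complex vec" assume v: "v \<in> carrier_vec k"
    have "(?M * P c) *\<^sub>v v = ?M *\<^sub>v (P c *\<^sub>v v)" using M Pc[OF c] v by (rule assoc_mult_mat_vec)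
    also have "\<dots> = 0\<^sub>v d" using act[OF c v] off y(2) c by simp
    finally show "(?M * P c) *\<^sub>v v = 0\<^sub>v d" .
  qed
  then have 1: "?M \<in> carrier_mat d d \<and> (\<forall>c\<in>Cn n. 0\<^sub>m d k = ?M * P c)" using M by simp
  have 2: "0\<^sub>m d d \<in> carrier_mat d d \<and> (\<forall>c\<in>Cn n. 0\<^sub>m d k = 0\<^sub>m d d * P c)"
    using left_mult_zero_mat[OF Pc] by simp
  have "balanced n ?F k \<rho> d (\<lambda>_. 0\<^sub>m d k)"
    using rep by (auto simp: balanced_def is_rep_def)
  then have "\<exists>!T. T \<in> carrier_mat d d \<and> (\<forall>c\<in>Cn n. 0\<^sub>m d k = T * P c)"
    using P unfolding is_tensor_def by blast
  with 1 2 show ?thesis by blast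
qed

text \<open>By \<open>FS_element_support\<close>, each basis element occurring in the squared
  integral has \<open>y\<close> and its inverse in one orbit. By assumption this is not the orbit of
  \<open>x\<close>, so each of them acts as zero.\<close>

lemma FS_indicator_eq_0:
  assumes n: "1 \<le> n" and ind: "is_induced n x k \<rho> d R" and rep: "is_rep (Fstab n x) k \<rho>"
    and no: "\<And>z b c. z \<in> Sn1 n \<Longrightarrow> b \<in> Cn n \<Longrightarrow> c \<in> Cn n \<Longrightarrow> ract n z b = x \<Longrightarrow>
      ract n (inv_into UNIV z) c = x \<Longrightarrow> False"
  shows "FS_indicator n R = 0"
proof -
  let ?f = "Jmu n (Jcomult n (Jintegral n))"
  define A where "A = {u \<in> Jidx n. ?f u \<noteq> 0}"
  have f: "?f \<in> Jcar n" using n by (rule Jmu_Jcar)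
  have "R ?f = 0\<^sub>m d d"
  proof (rule is_Jmodule_eq_0)
    show "is_Jmodule n d R" using ind by (simp add: is_induced_def)
    show "finite A" "A \<subseteq> Jidx n" by (auto simp: A_def)
    show "?f u = 0" if "u \<notin> A" for u using that f unfolding A_def Jcar_def by blast
    fix y g assume yg: "(y, g) \<in> A"
    then have y: "y \<in> Sn1 n" "g \<in> Cn n" by (auto simp: A_def Jidx_def)
    have "?f (y, g) \<noteq> 0" using yg by (simp add: A_def)
    from FS_element_support(2)[OF n this] obtain b where b: "b \<in> Cn n" "ract n y b = inv_into UNIV y"
      by blast
    obtain e where e: "e \<in> Cn n" "e \<circ> b = id" "b \<circ> e = id" using Cn_inverse[OF b(1)] .
    \<comment> \<open>Reversing the action leads from the inverse of \<open>y\<close> back to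
      \<open>y\<close>, so whatever \<open>y\<close> reaches is reached from its inverse
      too.\<close>
    have y_back: "ract n (inv_into UNIV y) e = y"
      using ract_cancel[OF n y(1) inv_Sn1[OF y(1)] b(1) e(1,3) b(2)] .
    show "R (Jbas y g) = 0\<^sub>m d d"
    proof (rule induced_vanishes_off_orbit[OF ind rep y])
      fix c assume c: "c \<in> Cn n"
      show "ract n y c \<noteq> x"
      proof
        assume x: "ract n y c = x"
        have "ract n (inv_into UNIV y) (e \<circ> c) = x"
          using ract_comp[OF n inv_Sn1[OF y(1)] e(1) c] y_back x by simp
        then show False using no[OF y(1) c comp_Cn[OF e(1) c] x] by blast
      qed
    qed
  qed
  then show ?thesis by (simp add: FS_indicator_def mtrace_def)
qed

section \<open>The induced module\<close>

lemma power_eq_cong: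
  fixes \<zeta> :: "'a :: monoid_mult"
  assumes "\<zeta> ^ n = 1" "[r = s] (mod n)"
  shows "\<zeta> ^ r = \<zeta> ^ s"
proof -
  have "\<zeta> ^ t = \<zeta> ^ (t mod n)" for t
  proof -
    have "\<zeta> ^ t = \<zeta> ^ (n * (t div n) + t mod n)" by simp
    then show ?thesis using assms(1) by (simp only: power_add power_mult power_one mult_1_left)
  qed
  then show ?thesis using assms(2) by (metis cong_def)
qed

text \<open>Exponents of equal parity differ by an element of the stabilizer. The inner fact assumes
  \<open>p \<le> q\<close> so that the difference is a natural number.\<close>

lemma Xset_ract_parity:
  assumes n: "1 \<le> n" and x: "x \<in> Xset n" and "even (p + q)"
  shows "ract n x (cyc n ^^ p) = ract n x (cyc n ^^ q)"
proof -
  have le: "ract n x (cyc n ^^ q) = ract n x (cyc n ^^ p)" if "p \<le> q" "even (p + q)" for p q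
  proof -
    have "even (q - p)" using that by simp
    then obtain k where "q - p = 2 * k" by (rule evenE)
    then have q: "q = 2 * k + p" using that by simp
    have xS: "x \<in> Sn1 n" using x by (simp add: Xset_def)
    have "(cyc n ^^ 2) ^^ k \<in> Fstab n x" using x unfolding Xset_def evenC_def by blast
    then have stab: "ract n x (cyc n ^^ (2 * k)) = x" by (simp add: Fstab_def evenC_pow)
    have "ract n (ract n x (cyc n ^^ (2 * k))) (cyc n ^^ p) = ract n x (cyc n ^^ q)"
      unfolding q using ract_comp[OF n xS, of "cyc n ^^ (2 * k)" "cyc n ^^ p"] by (simp add: funpow_add)
    then show ?thesis using stab by simp
  qed
  show ?thesis using le[of p q] le[of q p] assms(3) by (cases "p \<le> q") (auto simp: add.commute)
qed

lemma Cn_n: "1 \<le> n \<Longrightarrow> b \<in> Cn n \<Longrightarrow> cyc n ^^ b n = b"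
  using Cn_eq_pow_at_n(2)[of n b] by simp

lemma comp_n_cong:
  assumes "1 \<le> n" "b \<in> Cn n" "c \<in> Cn n"
  shows "[(b \<circ> c) n = b n + c n] (mod n)"
proof -
  have "b \<circ> c = cyc n ^^ (b n + c n)" using assms by (simp add: Cn_n funpow_add)
  then show ?thesis using cyc_pow_at_n[OF assms(1), of "b n + c n"] by simp
qed

text \<open>
  If \<open>F = \<langle>a\<^sup>2\<rangle>\<close> acts on \<open>\<complex>\<close> by \<open>a\<^sup>2 \<mapsto> \<zeta>\<^sup>2\<close>, the induced module has the basis
  \<open>\<zeta>\<^sup>-\<^sup>i a\<^sup>i \<otimes> 1\<close>, \<open>i = 0, 1\<close>; the exponent of \<open>b \<in> C\<^sub>n\<close> is read off as \<open>b n\<close>.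
\<close>

definition ind_rep :: "nat \<Rightarrow> prm \<Rightarrow> complex \<Rightarrow> jelt \<Rightarrow> complex mat" where
  "ind_rep n x \<zeta> f = mat 2 2 (\<lambda>(i, j). \<Sum>b\<in>Cn n.
     if even (b n + i + j) then f (ract n x (cyc n ^^ i), b) * \<zeta> ^ b n else 0)"

definition ind_tensor :: "nat \<Rightarrow> complex \<Rightarrow> prm \<Rightarrow> complex mat" where
  "ind_tensor n \<zeta> c = mat 2 1 (\<lambda>(i, j). if even (c n + i) then \<zeta> ^ c n else 0)"

context
  fixes n :: nat and x :: prm and \<zeta> :: complex
  assumes n: "1 \<le> n" "even n" and x: "x \<in> Xset n" and \<zeta>: "\<zeta> ^ n = 1"
begin

section \<open>The matrices define a unital module\<close>

lemma x_Sn1: "x \<in> Sn1 n"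
  using x by (simp add: Xset_def)

lemma \<zeta>_nonzero: "\<zeta> \<noteq> 0"
  using \<zeta> n by (auto simp: power_0_left)

lemma \<zeta>_comp: "b \<in> Cn n \<Longrightarrow> c \<in> Cn n \<Longrightarrow> \<zeta> ^ ((b \<circ> c) n) = \<zeta> ^ b n * \<zeta> ^ c n"
  using power_eq_cong[OF \<zeta> comp_n_cong[OF n(1)]] by (simp add: power_add)

lemma even_comp: "b \<in> Cn n \<Longrightarrow> c \<in> Cn n \<Longrightarrow> even ((b \<circ> c) n) \<longleftrightarrow> even (b n + c n)"
  using even_cong[OF n(2) comp_n_cong[OF n(1)]] by simp

lemma ract_coset:
  assumes "b \<in> Cn n" "even (b n + i + k)"
  shows "ract n (ract n x (cyc n ^^ i)) b = ract n x (cyc n ^^ k)"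
proof -
  have "ract n (ract n x (cyc n ^^ i)) b = ract n x (cyc n ^^ i \<circ> b)"
    using ract_comp[OF n(1) x_Sn1] assms by simp
  also have "cyc n ^^ i \<circ> b = cyc n ^^ (i + b n)" using assms n by (simp add: funpow_add Cn_n)
  also have "ract n x \<dots> = ract n x (cyc n ^^ k)"
    using assms by (intro Xset_ract_parity[OF n(1) x]) (simp add: ac_simps)
  finally show ?thesis .
qed

lemma ind_rep_carrier [simp]: "ind_rep n x \<zeta> f \<in> carrier_mat 2 2"
  "dim_row (ind_rep n x \<zeta> f) = 2" "dim_col (ind_rep n x \<zeta> f) = 2"
  by (simp_all add: ind_rep_def)

lemma ind_tensor_carrier [simp]: "ind_tensor n \<zeta> c \<in> carrier_mat 2 1"
  "dim_row (ind_tensor n \<zeta> c) = 2" "dim_col (ind_tensor n \<zeta> c) = 1"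
  by (simp_all add: ind_tensor_def)

lemma ind_rep_index:
  assumes "i < 2" "j < 2"
  shows "ind_rep n x \<zeta> f $$ (i, j) = (\<Sum>b\<in>Cn n.
     if even (b n + i + j) then f (ract n x (cyc n ^^ i), b) * \<zeta> ^ b n else 0)"
  using assms by (simp add: ind_rep_def)

text \<open>Summing over \<open>d = b c\<close> leaves a double sum over \<open>b\<close> and
  \<open>c\<close>. The parity of \<open>b n + i\<close> picks the intermediate index
  \<open>k\<close>, where acting by \<open>b\<close> takes the coset of \<open>a^i\<close> to that
  of \<open>a^k\<close>, and powers of \<open>\<zeta>\<close> multiply.\<close>

lemma ind_rep_mult: "ind_rep n x \<zeta> (Jmult n f g) = ind_rep n x \<zeta> f * ind_rep n x \<zeta> g"
proof (rule eq_matI)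
  fix i j assume "i < dim_row (ind_rep n x \<zeta> f * ind_rep n x \<zeta> g)"
    "j < dim_col (ind_rep n x \<zeta> f * ind_rep n x \<zeta> g)"
  then have ij: "i < 2" "j < 2" by simp_all
  let ?y = "ract n x (cyc n ^^ i)"
  have y: "?y \<in> Sn1 n" using n x_Sn1 by simp
  \<comment> \<open>The general term of entry \<open>(i, k)\<close> times entry
    \<open>(k, j)\<close>; for given \<open>b\<close> only the \<open>k\<close> of the right parity
    contributes.\<close>
  define T where "T k b c = (if even (b n + i + k) then f (?y, b) * \<zeta> ^ b n else 0) *
    (if even (c n + k + j) then g (ract n x (cyc n ^^ k), c) * \<zeta> ^ c n else 0)" for k b c
  have "ind_rep n x \<zeta> (Jmult n f g) $$ (i, j) = (\<Sum>d\<in>Cn n. if even (d n + i + j)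
      then (\<Sum>b\<in>Cn n. \<Sum>c\<in>Cn n. if b \<circ> c = d then f (?y, b) * g (ract n ?y b, c) else 0) * \<zeta> ^ d n else 0)"
    unfolding ind_rep_index[OF ij] Jmult_apply[OF n(1) y] by (rule refl)
  also have "\<dots> = (\<Sum>d\<in>Cn n. \<Sum>b\<in>Cn n. \<Sum>c\<in>Cn n.
      if b \<circ> c = d then (if even (d n + i + j) then f (?y, b) * g (ract n ?y b, c) * \<zeta> ^ d n else 0) else 0)"
  proof (intro sum.cong[OF refl, of "Cn n"])
    fix d
    let ?G = "\<lambda>b c. f (?y, b) * g (ract n ?y b, c)"
    show "(if even (d n + i + j) then (\<Sum>b\<in>Cn n. \<Sum>c\<in>Cn n. if b \<circ> c = d then ?G b c else 0) * \<zeta> ^ d n else 0) =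
        (\<Sum>b\<in>Cn n. \<Sum>c\<in>Cn n. if b \<circ> c = d then (if even (d n + i + j) then ?G b c * \<zeta> ^ d n else 0) else 0)"
    proof (cases "even (d n + i + j)")
      case True
      then show ?thesis unfolding sum_distrib_right if_P[OF True] by (intro sum.cong refl) simp
    next
      case False
      then show ?thesis unfolding if_not_P[OF False] by (intro sum.neutral[symmetric] ballI) simp
    qed
  qed
  also have "\<dots> = (\<Sum>b\<in>Cn n. \<Sum>d\<in>Cn n. \<Sum>c\<in>Cn n.
      if b \<circ> c = d then (if even (d n + i + j) then f (?y, b) * g (ract n ?y b, c) * \<zeta> ^ d n else 0) else 0)"
    by (rule sum.swap)
  also have "\<dots> = (\<Sum>b\<in>Cn n. \<Sum>c\<in>Cn n. \<Sum>d\<in>Cn n.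
      if d = b \<circ> c then (if even (d n + i + j) then f (?y, b) * g (ract n ?y b, c) * \<zeta> ^ d n else 0) else 0)"
  proof (rule sum.cong[OF refl])
    have "b \<circ> c = d \<longleftrightarrow> d = b \<circ> c" for b c d :: prm by blast
    then show "(\<Sum>d\<in>Cn n. \<Sum>c\<in>Cn n. if b \<circ> c = d then k c d else 0) =
        (\<Sum>c\<in>Cn n. \<Sum>d\<in>Cn n. if d = b \<circ> c then k c d else 0)" for b and k :: "prm \<Rightarrow> prm \<Rightarrow> complex"
      by (subst sum.swap) simp
  qed
  also have "\<dots> = (\<Sum>b\<in>Cn n. \<Sum>c\<in>Cn n. if even ((b \<circ> c) n + i + j)
      then f (?y, b) * g (ract n ?y b, c) * \<zeta> ^ ((b \<circ> c) n) else 0)"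
    by (intro sum.cong refl) (simp add: sum.delta del: comp_apply)
  also have "\<dots> = (\<Sum>b\<in>Cn n. \<Sum>c\<in>Cn n. T 0 b c + T 1 b c)"
  proof (intro sum.cong refl)
    fix b c assume bc: "b \<in> Cn n" "c \<in> Cn n"
    have e: "even ((b \<circ> c) n + i + j) \<longleftrightarrow> even (b n + c n + i + j)"
      using even_comp[OF bc] by presburger
    show "(if even ((b \<circ> c) n + i + j) then f (?y, b) * g (ract n ?y b, c) * \<zeta> ^ ((b \<circ> c) n) else 0) =
        T 0 b c + T 1 b c"
    proof (cases "even (b n + i)")
      case True
      then have "ract n ?y b = ract n x (cyc n ^^ 0)" using bc by (intro ract_coset) simp_all
      then show ?thesis using True unfolding e \<zeta>_comp[OF bc] T_def by (auto simp del: funpow_0)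
    next
      case False
      then have "ract n ?y b = ract n x (cyc n ^^ 1)" using bc by (intro ract_coset) simp_all
      then show ?thesis using False unfolding e \<zeta>_comp[OF bc] T_def by auto
    qed
  qed
  also have "\<dots> = (\<Sum>b\<in>Cn n. \<Sum>c\<in>Cn n. T 0 b c) + (\<Sum>b\<in>Cn n. \<Sum>c\<in>Cn n. T 1 b c)"
    by (simp only: sum.distrib)
  also have "\<dots> = ind_rep n x \<zeta> f $$ (i, 0) * ind_rep n x \<zeta> g $$ (0, j) +
      ind_rep n x \<zeta> f $$ (i, 1) * ind_rep n x \<zeta> g $$ (1, j)"
  proof -
    have "(\<Sum>b\<in>Cn n. \<Sum>c\<in>Cn n. T k b c) = ind_rep n x \<zeta> f $$ (i, k) * ind_rep n x \<zeta> g $$ (k, j)"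
      if "k < 2" for k
      unfolding ind_rep_index[OF ij(1) that] ind_rep_index[OF that ij(2)] T_def by (simp only: sum_product)
    then show ?thesis by simp
  qed
  finally show "ind_rep n x \<zeta> (Jmult n f g) $$ (i, j) = (ind_rep n x \<zeta> f * ind_rep n x \<zeta> g) $$ (i, j)"
    using ij by (simp add: scalar_prod_def numeral_2_eq_2)
qed simp_all

lemma ind_rep_one: "ind_rep n x \<zeta> (Jone n) = 1\<^sub>m 2"
proof (rule eq_matI)
  fix i j assume "i < dim_row (1\<^sub>m 2 :: complex mat)" "j < dim_col (1\<^sub>m 2 :: complex mat)"
  then have ij: "i < 2" "j < 2" by simp_all
  have one: "Jone n (y, b) = (if b = id then 1 else 0)" if "y \<in> Sn1 n" for y b
  proof -
    have "Jone n (y, b) = (\<Sum>z\<in>Sn1 n. if z = y then (if b = id then 1 else 0) else 0)"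
      unfolding Jone_def by (intro sum.cong) (auto simp: Jbas_def)
    then show ?thesis using that by simp
  qed
  \<comment> \<open>The exponent read off from \<open>id\<close> is \<open>n\<close> rather than 0,
    which agrees because \<open>n\<close> is even and \<open>\<zeta> ^ n = 1\<close>.\<close>
  have "ind_rep n x \<zeta> (Jone n) $$ (i, j) =
      (\<Sum>b\<in>Cn n. if b = id then (if even (n + i + j) then \<zeta> ^ n else 0) else 0)"
    unfolding ind_rep_index[OF ij] using n x_Sn1 by (intro sum.cong) (auto simp: one)
  also have "\<dots> = (if even (i + j) then 1 else 0)" using n \<zeta> by (simp add: sum.delta)
  also have "\<dots> = 1\<^sub>m 2 $$ (i, j)" using ij by (auto simp: less_2_cases_iff)
  finally show "ind_rep n x \<zeta> (Jone n) $$ (i, j) = 1\<^sub>m 2 $$ (i, j)" .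
qed simp_all

lemma ind_rep_Jmodule: "is_Jmodule n 2 (ind_rep n x \<zeta>)"
proof -
  have "ind_rep n x \<zeta> (\<lambda>w. f w + g w) = ind_rep n x \<zeta> f + ind_rep n x \<zeta> g" for f g
  proof (rule eq_matI)
    fix i j assume "i < dim_row (ind_rep n x \<zeta> f + ind_rep n x \<zeta> g)"
      "j < dim_col (ind_rep n x \<zeta> f + ind_rep n x \<zeta> g)"
    then have ij: "i < 2" "j < 2" by simp_all
    have "ind_rep n x \<zeta> (\<lambda>w. f w + g w) $$ (i, j) = ind_rep n x \<zeta> f $$ (i, j) + ind_rep n x \<zeta> g $$ (i, j)"
      unfolding ind_rep_index[OF ij] sum.distrib[symmetric]
      by (intro sum.cong[OF refl]) (simp add: distrib_right)
    then show "ind_rep n x \<zeta> (\<lambda>w. f w + g w) $$ (i, j) = (ind_rep n x \<zeta> f + ind_rep n x \<zeta> g) $$ (i, j)"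
      using ij by simp
  qed simp_all
  moreover have "ind_rep n x \<zeta> (\<lambda>w. s * f w) = s \<cdot>\<^sub>m ind_rep n x \<zeta> f" for s f
  proof (rule eq_matI)
    fix i j assume "i < dim_row (s \<cdot>\<^sub>m ind_rep n x \<zeta> f)" "j < dim_col (s \<cdot>\<^sub>m ind_rep n x \<zeta> f)"
    then have ij: "i < 2" "j < 2" by simp_all
    have "ind_rep n x \<zeta> (\<lambda>w. s * f w) $$ (i, j) = s * ind_rep n x \<zeta> f $$ (i, j)"
      unfolding ind_rep_index[OF ij] sum_distrib_left by (intro sum.cong[OF refl]) simp
    then show "ind_rep n x \<zeta> (\<lambda>w. s * f w) $$ (i, j) = (s \<cdot>\<^sub>m ind_rep n x \<zeta> f) $$ (i, j)"
      using ij by simp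
  qed simp_all
  ultimately show ?thesis by (simp add: is_Jmodule_def ind_rep_mult ind_rep_one)
qed

section \<open>The universal property of the tensor product\<close>

lemma ind_tensor_index:
  assumes "i < 2"
  shows "ind_tensor n \<zeta> (cyc n ^^ r) $$ (i, 0) = (if even (r + i) then \<zeta> ^ r else 0)"
proof -
  have c: "[(cyc n ^^ r) n = r] (mod n)" using n(1) by (rule cyc_pow_at_n)
  show ?thesis using assms power_eq_cong[OF \<zeta> c] even_cong[OF n(2) c] by (simp add: ind_tensor_def)
qed

text \<open>The column of \<open>a^r\<close> has a single nonzero entry, \<open>\<zeta> ^ r\<close>
  in row \<open>r mod 2\<close>, so it picks out one column of \<open>T\<close>.\<close>

lemma mult_ind_tensor_index:
  assumes "T \<in> carrier_mat e 2" "i < e"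
  shows "(T * ind_tensor n \<zeta> (cyc n ^^ r)) $$ (i, 0) = T $$ (i, r mod 2) * \<zeta> ^ r"
proof -
  have "(T * ind_tensor n \<zeta> (cyc n ^^ r)) $$ (i, 0) =
      T $$ (i, 0) * ind_tensor n \<zeta> (cyc n ^^ r) $$ (0, 0) + T $$ (i, 1) * ind_tensor n \<zeta> (cyc n ^^ r) $$ (1, 0)"
    using assms by (simp add: scalar_prod_def numeral_2_eq_2)
  then show ?thesis by (simp add: ind_tensor_index mod2_eq_if)
qed

text \<open>The cosets of \<open>a^2\<close> are represented by 1 and \<open>a\<close>, so a
  balanced family is determined by its values there, and these prescribe the two columns of the
  factoring matrix.\<close>

lemma is_tensor_ind_tensor:
  assumes rep: "is_rep (evenC n) 1 \<rho>"
    and \<rho>: "\<And>k. \<rho> (cyc n ^^ (2 * k)) $$ (0, 0) = \<zeta> ^ (2 * k)"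
  shows "is_tensor n (evenC n) 1 \<rho> 2 (ind_tensor n \<zeta>)"
  unfolding is_tensor_def
proof (intro conjI allI impI)
  have rc: "\<rho> h \<in> carrier_mat 1 1" if "h \<in> evenC n" for h using rep that by (simp add: is_rep_def)
  have even_in: "cyc n ^^ (2 * k) \<in> evenC n" for k using evenC_iff[OF n] by simp
  have r1: "(A * \<rho> (cyc n ^^ (2 * k))) $$ (i, 0) = A $$ (i, 0) * \<zeta> ^ (2 * k)"
    if "A \<in> carrier_mat e 1" "i < e" for A e i k
    using that rc[OF even_in[of k]] by (simp add: scalar_prod_def \<rho>)
  show "balanced n (evenC n) 1 \<rho> 2 (ind_tensor n \<zeta>)"
    unfolding balanced_def
  proof (intro conjI ballI)
    fix c f assume c: "c \<in> Cn n" and f: "f \<in> evenC n"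
    obtain r where r: "c = cyc n ^^ r" using c by (rule Cn_cases)
    obtain k where k: "f = cyc n ^^ (2 * k)" using f by (auto simp: evenC_def evenC_pow)
    show "ind_tensor n \<zeta> (c \<circ> f) = ind_tensor n \<zeta> c * \<rho> f"
    proof (rule eq_matI)
      fix i j assume "i < dim_row (ind_tensor n \<zeta> c * \<rho> f)" "j < dim_col (ind_tensor n \<zeta> c * \<rho> f)"
      then have ij: "i < 2" "j = 0" using rc[OF f] by simp_all
      have "c \<circ> f = cyc n ^^ (r + 2 * k)" by (simp only: r k funpow_add)
      then show "ind_tensor n \<zeta> (c \<circ> f) $$ (i, j) = (ind_tensor n \<zeta> c * \<rho> f) $$ (i, j)"
        using ij r1[OF ind_tensor_carrier(1) ij(1), of c k] ind_tensor_index[of i "r + 2 * k"] ind_tensor_index[of i r]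
        by (simp add: r k power_add)
    qed (use rc[OF f] in simp_all)
  qed (rule ind_tensor_carrier)
  fix e Q assume Q: "balanced n (evenC n) 1 \<rho> e Q"
  have Qc: "Q c \<in> carrier_mat e 1" if "c \<in> Cn n" for c using Q that unfolding balanced_def by blast
  have Qr: "Q (cyc n ^^ r) $$ (i, 0) = Q (cyc n ^^ (r mod 2)) $$ (i, 0) * \<zeta> ^ (2 * (r div 2))"
    if "i < e" for r i
  proof -
    have "cyc n ^^ r = cyc n ^^ (r mod 2 + 2 * (r div 2))" by simp
    also have "\<dots> = cyc n ^^ (r mod 2) \<circ> cyc n ^^ (2 * (r div 2))" by (simp only: funpow_add)
    finally have "Q (cyc n ^^ r) = Q (cyc n ^^ (r mod 2)) * \<rho> (cyc n ^^ (2 * (r div 2)))"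
      using Q even_in[of "r div 2"] by (simp only: balanced_def cyc_pow_Cn)
    then show ?thesis using r1[OF Qc[OF cyc_pow_Cn] that] by simp
  qed
  show "\<exists>!T. T \<in> carrier_mat e 2 \<and> (\<forall>c\<in>Cn n. Q c = T * ind_tensor n \<zeta> c)"
  proof (rule ex1I)
    \<comment> \<open>Basis vector \<open>j\<close> is \<open>a^j \<otimes> 1\<close> divided by
      \<open>\<zeta> ^ j\<close>, hence the division.\<close>
    define T where "T = mat e 2 (\<lambda>(i, j). Q (cyc n ^^ j) $$ (i, 0) / \<zeta> ^ j)"
    have T: "T \<in> carrier_mat e 2" by (simp add: T_def)
    have "Q c = T * ind_tensor n \<zeta> c" if c: "c \<in> Cn n" for c
    proof (rule eq_matI)
      obtain r where r: "c = cyc n ^^ r" using c by (rule Cn_cases)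
      fix i j assume "i < dim_row (T * ind_tensor n \<zeta> c)" "j < dim_col (T * ind_tensor n \<zeta> c)"
      then have ij: "i < e" "j = 0" using T by simp_all
      have "\<zeta> ^ r = \<zeta> ^ (r mod 2) * \<zeta> ^ (2 * (r div 2))" by (simp flip: power_add)
      then show "Q c $$ (i, j) = (T * ind_tensor n \<zeta> c) $$ (i, j)"
        using ij mult_ind_tensor_index[OF T ij(1), of r] Qr[OF ij(1), of r] \<zeta>_nonzero
        by (simp add: r T_def)
    qed (use Qc[OF c] T in simp_all)
    with T show "T \<in> carrier_mat e 2 \<and> (\<forall>c\<in>Cn n. Q c = T * ind_tensor n \<zeta> c)" by simp
    fix T' assume T': "T' \<in> carrier_mat e 2 \<and> (\<forall>c\<in>Cn n. Q c = T' * ind_tensor n \<zeta> c)"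
    show "T' = T"
    proof (rule eq_matI)
      fix i j assume "i < dim_row T" "j < dim_col T"
      then have ij: "i < e" "j < 2" by (simp_all add: T_def)
      have "Q (cyc n ^^ j) $$ (i, 0) = T' $$ (i, j) * \<zeta> ^ j"
        using T' mult_ind_tensor_index[of T' e i j] ij by simp
      then show "T' $$ (i, j) = T $$ (i, j)" using ij \<zeta>_nonzero by (simp add: T_def)
    qed (use T' T in auto)
  qed
qed

section \<open>Agreement with the induced action\<close>

lemma ind_rep_Jbas:
  assumes "y \<in> Sn1 n" "b \<in> Cn n" "i < 2" "j < 2"
  shows "ind_rep n x \<zeta> (Jbas y b) $$ (i, j) =
    (if y = ract n x (cyc n ^^ i) \<and> even (b n + i + j) then \<zeta> ^ b n else 0)"
proof -
  have "ind_rep n x \<zeta> (Jbas y b) $$ (i, j) = (\<Sum>c\<in>Cn n. if c = b then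
      (if y = ract n x (cyc n ^^ i) \<and> even (b n + i + j) then \<zeta> ^ b n else 0) else 0)"
    unfolding ind_rep_index[OF assms(3,4)] by (intro sum.cong) (auto simp: Jbas_def)
  then show ?thesis using assms(2) by (simp add: sum.delta)
qed

text \<open>On the orbit of \<open>x\<close> only parity matters, so acting by \<open>a^s\<close> is
  undone by any \<open>a^i\<close> with \<open>i\<close> of the same parity as
  \<open>s\<close>.\<close>

lemma ract_eq_base_iff:
  assumes y: "y \<in> Sn1 n" and si: "even (s + i)"
  shows "ract n y (cyc n ^^ s) = x \<longleftrightarrow> y = ract n x (cyc n ^^ i)"
proof
  assume y_eq: "y = ract n x (cyc n ^^ i)"
  have "ract n y (cyc n ^^ s) = ract n x (cyc n ^^ (i + s))"
    unfolding y_eq using ract_comp[OF n(1) x_Sn1, of "cyc n ^^ i" "cyc n ^^ s"] by (simp add: funpow_add)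
  also have "\<dots> = ract n x (cyc n ^^ 0)" using si by (intro Xset_ract_parity[OF n(1) x]) simp
  also have "\<dots> = x" using n x_Sn1 by (simp add: id_def[symmetric])
  finally show "ract n y (cyc n ^^ s) = x" .
next
  assume "ract n y (cyc n ^^ s) = x"
  \<comment> \<open>\<open>p\<close> represents \<open>-s\<close> modulo \<open>n\<close>; as
    \<open>n - 1\<close> is odd, it also has the parity of \<open>s\<close>.\<close>
  define p where "p = (n - 1) * s"
  have "s + p = n * s" using n by (cases n) (simp_all add: p_def)
  then have "cyc n ^^ (s + p) = cyc n ^^ 0" by (intro cyc_pow_cong) (simp add: cong_def)
  then have "cyc n ^^ s \<circ> cyc n ^^ p = id" by (simp add: funpow_add id_def)
  then have "ract n x (cyc n ^^ p) = y"
    using \<open>ract n y (cyc n ^^ s) = x\<close> by (intro ract_cancel[OF n(1) y x_Sn1]) auto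
  moreover have "even (p + i)" using si n by (auto simp: p_def)
  ultimately show "y = ract n x (cyc n ^^ i)" using Xset_ract_parity[OF n(1) x, of p i] by simp
qed

text \<open>For \<open>b = a^q\<close> and \<open>c = a^r\<close> only the row \<open>i\<close> with
  the parity of \<open>q + r\<close> can be nonzero, and there the condition
  \<open>y = ract n x (cyc n ^^ i)\<close> is the delta of the induced action.\<close>

lemma is_induced_ind_rep:
  assumes rep: "is_rep (evenC n) 1 \<rho>"
    and \<rho>: "\<And>k. \<rho> (cyc n ^^ (2 * k)) $$ (0, 0) = \<zeta> ^ (2 * k)"
  shows "is_induced n x 1 \<rho> 2 (ind_rep n x \<zeta>)"
  unfolding is_induced_def
proof (intro conjI exI ballI)
  let ?R = "ind_rep n x \<zeta>" and ?P = "ind_tensor n \<zeta>"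
  show "is_Jmodule n 2 ?R" by (rule ind_rep_Jmodule)
  show "is_tensor n (Fstab n x) 1 \<rho> 2 ?P"
    using is_tensor_ind_tensor[OF rep \<rho>] x by (simp add: Xset_def)
  fix y b c and v :: "complex vec"
  assume y: "y \<in> Sn1 n" and b: "b \<in> Cn n" and c: "c \<in> Cn n" and v: "v \<in> carrier_vec 1"
  obtain r where r: "c = cyc n ^^ r" using c by (rule Cn_cases)
  obtain q where q: "b = cyc n ^^ q" using b by (rule Cn_cases)
  have bc: "b \<circ> c = cyc n ^^ (q + r)" by (simp only: q r funpow_add)
  have bn: "even (b n) \<longleftrightarrow> even q" "\<zeta> ^ b n = \<zeta> ^ q"
    using cyc_pow_at_n[OF n(1), of q] even_cong[OF n(2)] power_eq_cong[OF \<zeta>] by (auto simp: q)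
  have "?R (Jbas y b) * ?P c = (if ract n y (b \<circ> c) = x then ?P (b \<circ> c) else 0\<^sub>m 2 1)"
  proof (rule eq_matI)
    let ?rhs = "if ract n y (b \<circ> c) = x then ?P (b \<circ> c) else 0\<^sub>m 2 1"
    fix i j assume "i < dim_row ?rhs" "j < dim_col ?rhs"
    then have ij: "i < 2" "j = 0" by (simp_all split: if_splits)
    have par: "even (b n + i + r mod 2) \<longleftrightarrow> even (q + r + i)" using bn(1) by presburger
    have "(?R (Jbas y b) * ?P c) $$ (i, j) = ?R (Jbas y b) $$ (i, r mod 2) * \<zeta> ^ r"
      unfolding r ij(2) by (rule mult_ind_tensor_index[OF ind_rep_carrier(1) ij(1)])
    also have "?R (Jbas y b) $$ (i, r mod 2) =
        (if y = ract n x (cyc n ^^ i) \<and> even (q + r + i) then \<zeta> ^ q else 0)"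
      using ind_rep_Jbas[OF y b ij(1), of "r mod 2"] par bn(2) by simp
    also have "\<dots> * \<zeta> ^ r =
        (if y = ract n x (cyc n ^^ i) \<and> even (q + r + i) then \<zeta> ^ (q + r) else 0)"
      by (simp add: power_add)
    also have "\<dots> = ?rhs $$ (i, j)"
      using ract_eq_base_iff[OF y, of "q + r" i] ij unfolding bc by (auto simp: ind_tensor_index)
    finally show "(?R (Jbas y b) * ?P c) $$ (i, j) = ?rhs $$ (i, j)" .
  qed simp_all
  moreover have zero_v: "0\<^sub>m 2 1 *\<^sub>v v = 0\<^sub>v 2" using v by (intro eq_vecI) auto
  ultimately have "(?R (Jbas y b) * ?P c) *\<^sub>v v = (if ract n y (b \<circ> c) = x then ?P (b \<circ> c) *\<^sub>v v else 0\<^sub>v 2)"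
    using zero_v by simp
  moreover have "(?R (Jbas y b) * ?P c) *\<^sub>v v = ?R (Jbas y b) *\<^sub>v (?P c *\<^sub>v v)"
    by (rule assoc_mult_mat_vec[OF ind_rep_carrier(1) ind_tensor_carrier(1) v])
  ultimately show "?R (Jbas y b) *\<^sub>v (?P c *\<^sub>v v) =
      (if ract n y (b \<circ> c) = x then ?P (b \<circ> c) *\<^sub>v v else 0\<^sub>v 2)" by simp
qed

end

section \<open>Representations of the stabilizer and the limit\<close>

lemma finite_evenC [simp]: "finite (evenC n)"
  by (rule finite_subset[OF _ finite_Cn[of n]]) (auto simp: evenC_def evenC_pow)

lemma evenC_power_self: "(cyc (2 * m) ^^ 2) ^^ m = id"
  using cyc_pow_self[of "2 * m"] by (simp only: evenC_pow)

lemma rep_funpow: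
  assumes "is_rep H k \<rho>" "\<And>j. g ^^ j \<in> H" "v \<in> carrier_vec k" "\<rho> g *\<^sub>v v = \<mu> \<cdot>\<^sub>v v"
  shows "\<rho> (g ^^ j) *\<^sub>v v = \<mu> ^ j \<cdot>\<^sub>v v"
proof (induction j)
  case 0
  have "\<rho> id = 1\<^sub>m k" using assms(1) by (simp add: is_rep_def)
  then show ?case using assms(3) by (simp flip: id_def)
next
  case (Suc j)
  have g: "g \<in> H" using assms(2)[of 1] by simp
  have c: "\<rho> g \<in> carrier_mat k k" "\<rho> (g ^^ j) \<in> carrier_mat k k"
    using assms(1) g assms(2) unfolding is_rep_def by blast+
  have "\<rho> (g ^^ Suc j) = \<rho> (g \<circ> g ^^ j)" by simp
  also have "\<dots> = \<rho> g * \<rho> (g ^^ j)" using assms(1) g assms(2) unfolding is_rep_def by blast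
  finally have "\<rho> (g ^^ Suc j) *\<^sub>v v = \<rho> g *\<^sub>v (\<rho> (g ^^ j) *\<^sub>v v)"
    using assoc_mult_mat_vec[OF c assms(3)] by simp
  also have "\<dots> = \<mu> ^ j \<cdot>\<^sub>v (\<rho> g *\<^sub>v v)" unfolding Suc by (rule mult_mat_vec[OF c(1) assms(3)])
  also have "\<dots> = \<mu> ^ Suc j \<cdot>\<^sub>v v" by (simp add: assms(4) smult_smult_assoc mult.commute)
  finally show ?case .
qed

text \<open>An eigenspace of the generator is invariant, hence the whole space, so the group acts by
  scalars. Every line is then invariant, and the line of the first unit vector must be
  everything.\<close>

lemma irrep_cyclic_dim:
  assumes irr: "is_irrep H k \<rho>" and H: "H = {g ^^ j | j. True}"
  shows "k = 1"
proof -
  have rep: "is_rep H k \<rho>" and k: "k > 0" using irr by (auto simp: is_irrep_def)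
  have gH: "g ^^ j \<in> H" for j using H by blast
  have g: "g \<in> H" using gH[of 1] by simp
  have car: "\<rho> h \<in> carrier_mat k k" if "h \<in> H" for h using rep that by (simp add: is_rep_def)
  have sub: "U = carrier_vec k"
    if "is_linear_subspace k U" "\<And>h v. h \<in> H \<Longrightarrow> v \<in> U \<Longrightarrow> \<rho> h *\<^sub>v v \<in> U" "w \<in> U" "w \<noteq> 0\<^sub>v k" for U w
    using irr that unfolding is_irrep_def by blast
  obtain \<mu> v where v: "eigenvector (\<rho> g) v \<mu>"
    using spectrum_non_empty[OF car[OF g] k] by (auto simp: spectrum_def eigenvalue_def)
  define U where "U = {v \<in> carrier_vec k. \<rho> g *\<^sub>v v = \<mu> \<cdot>\<^sub>v v}"
  have "U = carrier_vec k"
  proof (rule sub)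
    show "v \<in> U" "v \<noteq> 0\<^sub>v k" using v car[OF g] by (auto simp: eigenvector_def U_def)
    show "is_linear_subspace k U"
      unfolding is_linear_subspace_def
    proof (intro conjI ballI allI)
      show "0\<^sub>v k \<in> U" using car[OF g] by (auto simp: U_def intro!: eq_vecI)
      show "v + w \<in> U" if "v \<in> U" "w \<in> U" for v w
        using that mult_add_distrib_mat_vec[OF car[OF g], of v w] smult_add_distrib_vec[of v k w \<mu>]
        by (simp add: U_def)
      show "s \<cdot>\<^sub>v v \<in> U" if "v \<in> U" for s v
        using that mult_mat_vec[OF car[OF g], of v s] by (simp add: U_def smult_smult_assoc mult.commute)
    qed (auto simp: U_def)
    fix h v assume h: "h \<in> H" and v: "v \<in> U"
    obtain j where j: "h = g ^^ j" using h H by blast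
    have vc: "v \<in> carrier_vec k" "\<rho> g *\<^sub>v v = \<mu> \<cdot>\<^sub>v v" using v by (auto simp: U_def)
    have "\<rho> h *\<^sub>v v = \<mu> ^ j \<cdot>\<^sub>v v" unfolding j by (rule rep_funpow[OF rep gH vc])
    moreover have "\<mu> ^ j \<cdot>\<^sub>v v \<in> U"
      using vc mult_mat_vec[OF car[OF g] vc(1), of "\<mu> ^ j"] by (simp add: U_def smult_smult_assoc mult.commute)
    ultimately show "\<rho> h *\<^sub>v v \<in> U" by simp
  qed
  then have scalar: "\<rho> g *\<^sub>v v = \<mu> \<cdot>\<^sub>v v" if "v \<in> carrier_vec k" for v using that by (auto simp: U_def)
  define w :: "complex vec" where "w = unit_vec k 0"
  define L where "L = {s \<cdot>\<^sub>v w | s. True}"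
  have w: "w \<in> carrier_vec k" by (simp add: w_def)
  have "L = carrier_vec k"
  proof (rule sub)
    show "w \<in> L" unfolding L_def by (auto intro: exI[of _ 1])
    show "w \<noteq> 0\<^sub>v k" using k by (simp add: w_def)
    show "is_linear_subspace k L"
      unfolding is_linear_subspace_def
    proof (intro conjI ballI allI)
      show "L \<subseteq> carrier_vec k" using w by (auto simp: L_def)
      have "0\<^sub>v k = 0 \<cdot>\<^sub>v w" using w by auto
      then show "0\<^sub>v k \<in> L" unfolding L_def by blast
      show "u + v \<in> L" if uv: "u \<in> L" "v \<in> L" for u v
      proof -
        obtain s t where "u = s \<cdot>\<^sub>v w" "v = t \<cdot>\<^sub>v w" using uv by (auto simp: L_def)
        then have "u + v = (s + t) \<cdot>\<^sub>v w" by (simp add: add_smult_distrib_vec)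
        then show ?thesis unfolding L_def by blast
      qed
      show "s \<cdot>\<^sub>v v \<in> L" if v: "v \<in> L" for s v
        using v by (auto simp: L_def smult_smult_assoc)
    qed
    fix h v assume h: "h \<in> H" and v: "v \<in> L"
    obtain j where j: "h = g ^^ j" using h H by blast
    have vc: "v \<in> carrier_vec k" using v w by (auto simp: L_def)
    have "\<rho> h *\<^sub>v v = \<mu> ^ j \<cdot>\<^sub>v v" unfolding j by (rule rep_funpow[OF rep gH vc scalar[OF vc]])
    then show "\<rho> h *\<^sub>v v \<in> L" using v by (auto simp: L_def smult_smult_assoc)
  qed
  then have line: "v \<in> carrier_vec k \<Longrightarrow> \<exists>s. v = s \<cdot>\<^sub>v w" for v unfolding L_def by blast
  show "k = 1"
  proof (rule ccontr)
    assume "k \<noteq> 1"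
    with k have k2: "1 < k" by simp
    obtain s where s: "unit_vec k 1 = s \<cdot>\<^sub>v w" using line[of "unit_vec k 1"] by auto
    have "(1::complex) = unit_vec k 1 $ 1" using k2 by simp
    also have "\<dots> = s * w $ 1" unfolding s using k2 w by simp
    finally show False using k2 by (simp add: w_def)
  qed
qed

lemma rep_dim1_power:
  assumes rep: "is_rep H 1 \<rho>" and gH: "\<And>j. g ^^ j \<in> H"
  shows "\<rho> (g ^^ j) $$ (0, 0) = (\<rho> g $$ (0, 0)) ^ j"
proof (induction j)
  case 0
  have "\<rho> id = 1\<^sub>m 1" using rep by (simp add: is_rep_def)
  then show ?case by (simp flip: id_def)
next
  case (Suc j)
  have g: "g \<in> H" using gH[of 1] by simp
  have c: "\<rho> g \<in> carrier_mat 1 1" "\<rho> (g ^^ j) \<in> carrier_mat 1 1"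
    using rep g gH unfolding is_rep_def by blast+
  have "\<rho> (g ^^ Suc j) = \<rho> (g \<circ> g ^^ j)" by simp
  also have "\<dots> = \<rho> g * \<rho> (g ^^ j)" using rep g gH unfolding is_rep_def by blast
  also have "\<dots> $$ (0, 0) = \<rho> g $$ (0, 0) * \<rho> (g ^^ j) $$ (0, 0)"
    using c by (simp add: scalar_prod_def)
  finally show ?case by (simp only: Suc power_Suc)
qed

text \<open>A map constant on the fibres of \<open>f\<close> factors through \<open>f\<close>. This
  carries finiteness from characters over to isomorphism classes.\<close>

lemma finite_image_factor:
  assumes "finite (f ` A)" "\<And>a b. a \<in> A \<Longrightarrow> b \<in> A \<Longrightarrow> f a = f b \<Longrightarrow> g a = g b"
  shows "finite (g ` A)"
proof -
  have "g a = g (inv_into A f (f a))" if "a \<in> A" for a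
    using assms(2)[OF that inv_into_into[of "f a" f A]] that by (simp add: f_inv_into_f)
  then have "g ` A \<subseteq> (\<lambda>b. g (inv_into A f b)) ` f ` A" by blast
  then show ?thesis using assms(1) finite_surj by blast
qed

text \<open>Every irreducible representation is one-dimensional and is determined on
  \<open>H\<close> by its matrix entry, whose values are \<open>m\<close>-th roots of unity.\<close>

lemma finite_Irr_cyclic:
  assumes H: "H = {g ^^ j | j. True}" "finite H" and g: "g ^^ m = id" "m > 0"
  shows "finite (Irr H)"
proof -
  \<comment> \<open>Representations take arbitrary values outside \<open>H\<close>; restricting
    places the characters in a finite function space.\<close>
  define f where "f = (\<lambda>(k :: nat, \<rho> :: prm \<Rightarrow> complex mat). restrict (\<lambda>h. \<rho> h $$ (0, 0)) H)"
  have gH: "g ^^ j \<in> H" for j using H by blast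
  have dim: "k = 1 \<and> is_rep H 1 \<rho>" if "(k, \<rho>) \<in> irreps H" for k \<rho>
  proof -
    have "is_irrep H k \<rho>" using that by (simp add: irreps_def)
    moreover from this have "k = 1" using H(1) by (rule irrep_cyclic_dim)
    ultimately show ?thesis by (simp add: is_irrep_def)
  qed
  have "f ` irreps H \<subseteq> PiE H (\<lambda>_. {z. z ^ m = 1})"
  proof (rule image_subsetI)
    fix p assume p: "p \<in> irreps H"
    obtain k \<rho> where kr: "p = (k, \<rho>)" by fastforce
    have rep: "is_rep H 1 \<rho>" using dim p kr by blast
    have "(\<rho> h $$ (0, 0)) ^ m = 1" if "h \<in> H" for h
    proof -
      obtain j where j: "h = g ^^ j" using \<open>h \<in> H\<close> H by blast
      have "(\<rho> h $$ (0, 0)) ^ m = (\<rho> g $$ (0, 0) ^ m) ^ j"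
        unfolding j rep_dim1_power[OF rep gH] by (simp only: mult.commute flip: power_mult)
      also have "\<rho> g $$ (0, 0) ^ m = \<rho> id $$ (0, 0)"
        using rep_dim1_power[OF rep gH, of m] g by simp
      also have "\<dots> = 1" using rep by (simp add: is_rep_def)
      finally show ?thesis by simp
    qed
    then show "f p \<in> PiE H (\<lambda>_. {z. z ^ m = 1})" by (simp add: f_def kr)
  qed
  moreover have "finite (PiE H (\<lambda>_. {z::complex. z ^ m = 1}))"
    using H(2) g(2) finite_roots_unity[of m] by (intro finite_PiE) auto
  ultimately have fin: "finite (f ` irreps H)" by (rule finite_subset)
  have "finite ((\<lambda>p. rep_iso H `` {p}) ` irreps H)"
  proof (rule finite_image_factor[OF fin])
    fix p q assume p: "p \<in> irreps H" and q: "q \<in> irreps H" and eq: "f p = f q"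
    obtain k \<rho> l \<sigma> where kr: "p = (k, \<rho>)" "q = (l, \<sigma>)" by fastforce
    have reps: "k = 1" "l = 1" "is_rep H 1 \<rho>" "is_rep H 1 \<sigma>" using dim p q kr by auto
    have "\<rho> h = \<sigma> h" if h: "h \<in> H" for h
    proof -
      have "\<rho> h $$ (0, 0) = \<sigma> h $$ (0, 0)" using fun_cong[OF eq, of h] h by (simp add: f_def kr)
      moreover have "\<rho> h \<in> carrier_mat 1 1" "\<sigma> h \<in> carrier_mat 1 1"
        using reps h unfolding is_rep_def by blast+
      ultimately show ?thesis by (intro eq_matI) auto
    qed
    then show "rep_iso H `` {p} = rep_iso H `` {q}"
      using p q reps unfolding kr by (auto simp: rep_iso_def)
  qed
  moreover have "Irr H = (\<lambda>p. rep_iso H `` {p}) ` irreps H" by (auto simp: Irr_def quotient_def)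
  ultimately show ?thesis by simp
qed

text \<open>The trivial one-dimensional representation is irreducible.\<close>

lemma Irr_nonempty: "Irr H \<noteq> {}"
proof -
  let ?\<rho> = "\<lambda>_ :: prm. 1\<^sub>m 1 :: complex mat"
  have "U = {0\<^sub>v 1} \<or> U = carrier_vec 1" if U: "is_linear_subspace 1 U" for U
  proof (cases "U \<subseteq> {0\<^sub>v 1}")
    case True
    then show ?thesis using U by (auto simp: is_linear_subspace_def)
  next
    case False
    then obtain v where v: "v \<in> U" "v \<noteq> 0\<^sub>v 1" by blast
    have Uc: "U \<subseteq> carrier_vec 1" using U by (simp add: is_linear_subspace_def)
    then have vc: "v \<in> carrier_vec 1" using v by blast
    have v0: "v $ 0 \<noteq> 0"
    proof
      assume "v $ 0 = 0"
      then have "v = 0\<^sub>v 1" using vc by (intro eq_vecI) auto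
      with v show False by simp
    qed
    have "w \<in> U" if w: "w \<in> carrier_vec 1" for w
    proof -
      have "w = (w $ 0 / v $ 0) \<cdot>\<^sub>v v" using w vc v0 by (intro eq_vecI) auto
      moreover have "(w $ 0 / v $ 0) \<cdot>\<^sub>v v \<in> U" using U v unfolding is_linear_subspace_def by blast
      ultimately show ?thesis by simp
    qed
    then show ?thesis using Uc by blast
  qed
  then have "is_irrep H 1 ?\<rho>" by (auto simp: is_irrep_def is_rep_def)
  then have "(1, ?\<rho>) \<in> irreps H" by (simp add: irreps_def)
  then show ?thesis unfolding Irr_def quotient_def by blast
qed

lemma Irr_rep:
  assumes "C \<in> Irr H"
  obtains k \<rho> where "(k, \<rho>) \<in> C" "(k, \<rho>) \<in> irreps H"
proof -
  obtain k \<rho> where kr: "C = rep_iso H `` {(k, \<rho>)}" "(k, \<rho>) \<in> irreps H"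
    using assms by (auto simp: Irr_def quotient_def)
  have "is_irrep H k \<rho>" using kr(2) by (simp add: irreps_def)
  then have "\<rho> h \<in> carrier_mat k k" if "h \<in> H" for h using that by (simp add: is_irrep_def is_rep_def)
  then have "\<forall>h\<in>H. 1\<^sub>m k * \<rho> h = \<rho> h * 1\<^sub>m k"
    by (metis left_mult_one_mat right_mult_one_mat)
  moreover have "invertible_mat (1\<^sub>m k :: complex mat)"
    unfolding invertible_mat_def inverts_mat_def by (auto intro!: exI[of _ "1\<^sub>m k"])
  ultimately have "(k, \<rho>) \<in> C" using kr(2) unfolding kr(1) rep_iso_def
    by (auto intro!: bexI[of _ "1\<^sub>m k"])
  then show ?thesis using that kr(2) by blast
qed

lemma Irr_irreps:
  assumes "C \<in> Irr H" "(k, \<rho>) \<in> C"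
  shows "(k, \<rho>) \<in> irreps H"
  using assms by (auto simp: Irr_def quotient_def rep_iso_def)


section \<open>Comparing the two counts\<close>

lemma dim2_irreps_eq: "dim2_irreps n = Xset n \<times> Irr (evenC n)"
  by (auto simp: dim2_irreps_def Xset_def evenC_def)

text \<open>The description in \<open>induced_indicator\<close> needs a value that is unique and
  attained: every induced module has indicator 0 by the orbit argument, and \<open>ind_rep\<close>
  supplies an induced module.\<close>

lemma induced_indicator_eq_0:
  assumes m: "1 \<le> m" and x: "x \<in> Xset (2 * m)" "x \<notin> Xinv m" and C: "C \<in> Irr (evenC (2 * m))"
  shows "induced_indicator (2 * m) x C = 0"
proof -
  let ?n = "2 * m"
  let ?H = "evenC ?n"
  have n: "1 \<le> ?n" "even ?n" using m by simp_all
  have F: "Fstab ?n x = ?H" using x(1) by (simp add: Xset_def)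
  have zero: "FS_indicator ?n R = 0"
    if "(k, \<rho>) \<in> C" "is_induced ?n x k \<rho> d R" for k \<rho> d R
  proof (rule FS_indicator_eq_0[OF n(1) that(2)])
    show "is_rep (Fstab ?n x) k \<rho>"
      using Irr_irreps[OF C that(1)] by (simp add: F irreps_def is_irrep_def)
    show False if "z \<in> Sn1 ?n" "b \<in> Cn ?n" "c \<in> Cn ?n" "ract ?n z b = x" "ract ?n (inv_into UNIV z) c = x"
      for z b c
      using Xinv_if_self_inverse_orbit[OF m x(1) that] x(2) by blast
  qed
  obtain k \<rho> where kr: "(k, \<rho>) \<in> C" "(k, \<rho>) \<in> irreps ?H" using Irr_rep[OF C] .
  let ?g = "cyc ?n ^^ 2"
  have irr: "is_irrep ?H k \<rho>" using kr(2) by (simp add: irreps_def)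
  have k: "k = 1" using irr evenC_def by (rule irrep_cyclic_dim)
  have rep: "is_rep ?H 1 \<rho>" using irr by (simp add: is_irrep_def k)
  have gH: "?g ^^ j \<in> ?H" for j unfolding evenC_def by blast
  \<comment> \<open>A square root of the value at \<open>a^2\<close>; then
    \<open>\<zeta> ^ n\<close> is the value at \<open>(a^2)^m = id\<close>, which is 1.\<close>
  define \<zeta> where "\<zeta> = csqrt (\<rho> ?g $$ (0, 0))"
  have \<rho>: "\<rho> (cyc ?n ^^ (2 * j)) $$ (0, 0) = \<zeta> ^ (2 * j)" for j
    using rep_dim1_power[OF rep gH, of j] by (simp only: evenC_pow power_mult \<zeta>_def power2_csqrt)
  have "\<zeta> ^ ?n = \<rho> id $$ (0, 0)" using \<rho>[of m] cyc_pow_self[of ?n] by simp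
  also have "\<dots> = 1" using rep by (simp add: is_rep_def)
  finally have "is_induced ?n x 1 \<rho> 2 (ind_rep ?n x \<zeta>)"
    using is_induced_ind_rep[OF n x(1) _ rep \<rho>] by blast
  with kr(1) have "\<exists>k \<rho> d R. (k, \<rho>) \<in> C \<and> is_induced ?n x k \<rho> d R \<and> 0 = FS_indicator ?n R"
    using zero unfolding k by metis
  then show ?thesis
    unfolding induced_indicator_def using zero by (intro the_equality) auto
qed

lemma dim2_irreps_pm1_subset:
  assumes "1 \<le> m"
  shows "dim2_irreps_pm1 (2 * m) \<subseteq> Xinv m \<times> Irr (evenC (2 * m))"
  using induced_indicator_eq_0[OF assms] by (fastforce simp: dim2_irreps_pm1_def dim2_irreps_eq)

lemma finite_Irr_evenC:
  assumes "1 \<le> m"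
  shows "finite (Irr (evenC (2 * m)))"
  using assms by (intro finite_Irr_cyclic[OF evenC_def finite_evenC evenC_power_self]) simp

lemma card_dim2_irreps_nonzero:
  assumes "3 \<le> m"
  shows "card (dim2_irreps (2 * m)) \<noteq> 0"
proof -
  have "finite (Xset (2 * m))" by (simp add: Xset_def)
  then show ?thesis
    using Xset_nonempty[OF assms] finite_Irr_evenC[of m] Irr_nonempty[of "evenC (2 * m)"] assms
    by (simp add: dim2_irreps_eq card_cartesian_product card_eq_0_iff)
qed

text \<open>Both counts are bounded through products with the same set of isomorphism classes, so
  the bound for \<open>Xinv\<close> inside \<open>Xset\<close> carries over.\<close>

lemma ratio_le:
  fixes K m :: nat
  assumes m: "3 \<le> m" and K: "81 ^ K \<le> m" "K > 0"
  shows "real (card (dim2_irreps_pm1 (2 * m))) / real (card (dim2_irreps (2 * m))) \<le> 1 / real K"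
proof -
  let ?I = "Irr (evenC (2 * m))"
  have m1: "1 \<le> m" using m by simp
  obtain W :: "nat set" where W: "finite W" "card W = K" "\<And>w. w \<in> W \<Longrightarrow> coprime w (2 * m)"
    "\<And>v w. v \<in> W \<Longrightarrow> w \<in> W \<Longrightarrow> [v\<^sup>2 = w\<^sup>2] (mod m) \<Longrightarrow> v = w"
    using exists_distinct_squares[OF K(1)] by blast
  have KX: "K * card (Xinv m) \<le> card (Xset (2 * m))"
    using card_Xinv_le[OF m1 W(1,3,4)] W(2) by simp
  have "finite (Xinv m)" by (simp add: Xinv_def Xset_def)
  then have "card (dim2_irreps_pm1 (2 * m)) \<le> card (Xinv m \<times> ?I)"
    using dim2_irreps_pm1_subset[OF m1] finite_Irr_evenC[OF m1] by (intro card_mono) auto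
  then have "K * card (dim2_irreps_pm1 (2 * m)) \<le> K * (card (Xinv m) * card ?I)"
    by (simp add: card_cartesian_product)
  also have "\<dots> \<le> card (Xset (2 * m)) * card ?I"
    using mult_le_mono1[OF KX, of "card ?I"] by (simp only: mult.assoc)
  also have "\<dots> = card (dim2_irreps (2 * m))" by (simp add: dim2_irreps_eq card_cartesian_product)
  finally have "real K * real (card (dim2_irreps_pm1 (2 * m))) \<le> real (card (dim2_irreps (2 * m)))"
    by (simp only: of_nat_le_iff flip: of_nat_mult)
  then show ?thesis using card_dim2_irreps_nonzero[OF m] K(2) by (simp add: field_simps)
qed

theorem theorem7p6:
  shows "(\<forall>\<^sub>F m in sequentially. card (dim2_irreps (2 * m)) \<noteq> 0) \<and>
    (\<lambda>m. real (card (dim2_irreps_pm1 (2 * m))) / real (card (dim2_irreps (2 * m)))) \<longlonglongrightarrow> 0"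
proof
  show "\<forall>\<^sub>F m in sequentially. card (dim2_irreps (2 * m)) \<noteq> 0"
    using card_dim2_irreps_nonzero by (auto simp: eventually_sequentially)
  let ?q = "\<lambda>m. real (card (dim2_irreps_pm1 (2 * m))) / real (card (dim2_irreps (2 * m)))"
  show "?q \<longlonglongrightarrow> 0"
  proof (rule LIMSEQ_I)
    fix e :: real assume "e > 0"
    then obtain K where K: "K > 0" "1 / real K < e"
      using reals_Archimedean[of e] by (metis inverse_eq_divide zero_less_Suc)
    \<comment> \<open>The bound 3 keeps the denominator nonzero; the bound \<open>81 ^ K\<close>
      provides the \<open>K\<close> units.\<close>
    have "norm (?q m - 0) < e" if "m \<ge> max 3 (81 ^ K)" for m
      using ratio_le[of m K] that K by simp
    then show "\<exists>no. \<forall>m\<ge>no. norm (?q m - 0) < e" by blast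
  qed
qed

end
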